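(* Let $\alpha\in(0,1)$, $\beta\in[1-\frac1\alpha,\infty)$, and set $\beta_\alpha=\beta+\frac1\alpha-1$, $\bar\beta_\alpha=\alpha\beta_\alpha=\alpha\beta-\alpha+1\ge0$. Write $$\overline{C}_\alpha=\alpha^\alpha\frac{\cos^{\alpha+1}(\frac\pi2\alpha)}{\sin^\alpha(\frac\pi2\alpha)},\qquad \overline{B}_\alpha=\alpha^\alpha\frac{\csc\big(\frac{\pi}{2(1+\alpha)}\big)}{\sin^\alpha\big(\frac{\pi\alpha}{2(1+\alpha)}\big)},\qquad \overline{A}_\alpha=(1+\alpha)^{\alpha+1},$$ with $\overline{C}_\alpha\le\overline{B}_\alpha\le\overline{A}_\alpha$. Then the following bounds hold. (1) For any $a>-\beta_\alpha$ and any fixed $x>0$, we have, for any $0<\epsilon<\alpha$ and $n$ large, $$|\mathcal{W}_n(x)|=O\Big(n^{\frac32-a}\csc\big((\alpha-\epsilon)\tfrac\pi2\big)^n x^{-a}\Big).$$ (2) Let $x=\bar\kappa_\alpha(\theta)n^\alpha$, $\theta\in(0,\frac\pi2)$, where $$\theta\mapsto\bar\kappa_\alpha(\theta)=\alpha^\alpha\left(\frac{\sin((1+\alpha)\theta)}{\sin\theta}\right)\left(\frac{\sin((1+\alpha)\theta)}{\sin(\alpha\theta)}\right)^\alpha$$ is a decreasing function for each $\alpha\in(0,1]$ with (limiting) values $\bar\kappa_\alpha(0)=\overline{A}_\alpha$, $\bar\kappa_\alpha\big(\frac{\pi}{2(1+\alpha)}\big)=\overline{B}_\alpha$, $\bar\kappa_\alpha(\frac\pi2)=\overline{C}_\alpha$.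 Then, for any $0<\bar\alpha<1$ and $\bar\theta\in(0,\frac\pi2)$, uniformly on $\alpha>\bar\alpha$ and $0<\theta<\bar\theta$, we have $$|\mathcal{W}_n(x)|\le C(\alpha,\theta)\,x^{\beta_\alpha}\exp\left\{n\left(-\alpha\frac{\sin((1+\alpha)\theta)\cos\theta}{\sin(\alpha\theta)}+\ln\frac{\sin\theta}{\sin(\alpha\theta)}\right)\right\},$$ with $C(\alpha,\theta)=C(\bar\theta,\bar\alpha)\left(\cos\theta\left(\frac{\sin\theta}{\sin((1+\alpha)\theta)}\right)^{\frac1\alpha}\right)^{\bar\beta_\alpha+\frac12}$, where $C(\bar\theta,\bar\alpha)>0$. (3) For any $0<\bar\alpha<1$ and $0<\epsilon<\overline{B}_\alpha-\overline{C}_\alpha$ there is $n_0\in\mathbb{N}$ such that for $n\ge n_0$, uniformly on $1\ge\alpha\ge\bar\alpha$ (resp. on $\alpha>0$) and $x\in\big((\overline{C}_\alpha+\epsilon)n^\alpha,\overline{A}_\alpha n^\alpha\big)$ (resp. $x\in\big(\overline{B}_\alpha n^\alpha,\overline{A}_\alpha n^\alpha\big)$), $$|\mathcal{W}_n(x)|=O\Big(x^{\beta_\alpha}e^{-\frac12x^{1/\alpha}}e^{n\left(-\ln\alpha+\frac12(1+\alpha)^{\frac{1+\alpha}{\alpha}}-1-\alpha\right)}\Big).$$ (4) Uniformly on $x\ge\overline{A}_\alpha n^\alpha$, for any $\eta<1$, $$|\mathcal{W}_n(x)|=O\Big(\alpha^{-\frac52}\,x^{\beta_\alpha}e^{-\eta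 x^{1/\alpha}}e^{nH_{\alpha,\eta}}\Big),$$ where, with $E_\alpha=[(\alpha+1)^{-1/\alpha},1)$, so that $[\frac12,1)\subset E_\alpha$ for all $\alpha\in(0,1)$, $$H_{\alpha,\eta}=\big(\eta(1+\alpha)^{\frac{\alpha+1}{\alpha}}-(\alpha+1)-\ln\alpha\big)\mathbf{1}_{\{\eta\notin E_\alpha\}}-\ln(\eta^{-\alpha}-1)\,\mathbf{1}_{\{\eta\in E_\alpha\}},$$ which for $0<\eta<1$ equals $\max\big\{\eta(1+\alpha)^{\frac{\alpha+1}{\alpha}}-(\alpha+1)-\ln\alpha\,;\,-\ln(\eta^{-\alpha}-1)\big\}$, and $\lim_{\alpha\uparrow1}\lim_{\eta\to\frac12}H_{\alpha,\eta}=0$.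
   Context: For $n\in\mathbb{N}$ and $x>0$, $\mathcal{W}_n(x)=\frac1{n!}\frac{d^n}{dx^n}\big(x^n\mathbf{e}_{\alpha,\beta}(x)\big)$ with $\mathbf{e}_{\alpha,\beta}(x)=\frac{x^{\beta+\frac1\alpha-1}e^{-x^{1/\alpha}}}{\alpha\,\Gamma(\alpha\beta+1)}$. The $O$'s are as $n\to\infty$.
   Formalization: In (3), second range (uniformly on α>0), the implied constant is K/α with K and n_0 independent of α and x, since no constant independent of α works as α tends to 0 (the quotient grows like 1/α for fixed n). *)

theory Defs
  imports "HOL-Analysis.Analysis" "HOL-Library.Landau_Symbols"
begin

text \<open>
  All functions of a real argument below are only meant for a positive argument \<open>x\<close>, where
  \<open>powr\<close> is the usual real power.
\<close>

definition e_dens :: "real \<Rightarrow> real \<Rightarrow> real \<Rightarrow> real" where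
  "e_dens \<alpha> \<beta> x =
     x powr (\<beta> + 1 / \<alpha> - 1) * exp (- (x powr (1 / \<alpha>))) / (\<alpha> * Gamma (\<alpha> * \<beta> + 1))"

definition W :: "real \<Rightarrow> real \<Rightarrow> nat \<Rightarrow> real \<Rightarrow> real" where
  "W \<alpha> \<beta> n x = (deriv ^^ n) (\<lambda>t. t ^ n * e_dens \<alpha> \<beta> t) x / fact n"

definition beta_sub :: "real \<Rightarrow> real \<Rightarrow> real" where
  "beta_sub \<alpha> \<beta> = \<beta> + 1 / \<alpha> - 1"

definition beta_bar :: "real \<Rightarrow> real \<Rightarrow> real" where
  "beta_bar \<alpha> \<beta> = \<alpha> * beta_sub \<alpha> \<beta>"

definition csc :: "real \<Rightarrow> real" where
  "csc t = 1 / sin t"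

definition C_bar :: "real \<Rightarrow> real" where
  "C_bar \<alpha> = \<alpha> powr \<alpha> * (cos (pi / 2 * \<alpha>) powr (\<alpha> + 1) / sin (pi / 2 * \<alpha>) powr \<alpha>)"

definition B_bar :: "real \<Rightarrow> real" where
  "B_bar \<alpha> =
     \<alpha> powr \<alpha> * (csc (pi / (2 * (1 + \<alpha>))) / sin (pi * \<alpha> / (2 * (1 + \<alpha>))) powr \<alpha>)"

definition A_bar :: "real \<Rightarrow> real" where
  "A_bar \<alpha> = (1 + \<alpha>) powr (\<alpha> + 1)"

definition kappa_bar :: "real \<Rightarrow> real \<Rightarrow> real" where
  "kappa_bar \<alpha> \<theta> =
     \<alpha> powr \<alpha> * (sin ((1 + \<alpha>) * \<theta>) / sin \<theta>) * (sin ((1 + \<alpha>) * \<theta>) / sin (\<alpha> * \<theta>)) powr \<alpha>"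

definition E_int :: "real \<Rightarrow> real set" where
  "E_int \<alpha> = {(\<alpha> + 1) powr (- 1 / \<alpha>) ..< 1}"

text \<open>
  The two indicator functions are rendered by a case distinction; for \<open>\<eta> \<le> 0\<close> the power
  \<open>\<eta> powr (- \<alpha>)\<close> is never used, since \<open>E_int \<alpha>\<close> contains only positive numbers.
\<close>

definition H :: "real \<Rightarrow> real \<Rightarrow> real" where
  "H \<alpha> \<eta> =
     (if \<eta> \<in> E_int \<alpha> then - ln (\<eta> powr (- \<alpha>) - 1)
      else \<eta> * (1 + \<alpha>) powr ((\<alpha> + 1) / \<alpha>) - (\<alpha> + 1) - ln \<alpha>)"

end

theory Submission
  imports Defs "HOL-Complex_Analysis.Complex_Analysis" "HOL-Real_Asymp.Real_Asymp"
begin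

text \<open>
  Write \<open>z = x * v powr \<alpha>\<close> and \<open>X = x powr (1 / \<alpha>)\<close>. Cauchy's formula for the derivatives then turns
  \<open>W \<alpha> \<beta> n x\<close> into \<open>x powr beta_sub \<alpha> \<beta> / Gamma (\<alpha> * \<beta> + 1)\<close> times an integral over the boundary of
  a rectangle in the half-plane \<open>Re v > 0\<close> around \<open>v = 1\<close>; the integrand has modulus
  \<open>\<bar>v\<bar> powr (beta_bar \<alpha> \<beta> - 1) * q ^ (n + 1) * exp (- X * Re v)\<close> with the kernel
  \<open>q = \<bar>v powr \<alpha>\<bar> / \<bar>v powr \<alpha> - 1\<bar>\<close> (\<open>abs_W_le_rectangle\<close>). No steepest descent path is needed: on the
  left side \<open>Re v = \<sigma>\<close> the exponential is constant, so the whole question is how large the kernel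
  gets on a vertical line.

  Along such a line, parametrised by the argument \<open>\<psi>\<close> of \<open>v\<close>, the kernel increases exactly as long
  as \<open>\<sigma> powr \<alpha>\<close> stays below \<open>saddle_locus \<alpha> \<psi>\<close>, the \<open>\<alpha>\<close>-th power of the real part of the saddle
  point with argument \<open>\<psi>\<close>. This locus moves to the left as \<open>\<psi>\<close> grows, which is a consequence of the
  concavity of \<open>t * cot t\<close>. Hence the maximum sits at the saddle points on the line if there are
  any, with value \<open>sin \<theta> / sin (\<alpha> * \<theta>)\<close> (\<open>kernel_on_line_saddle\<close>); if the line lies to the right
  of \<open>merge_point \<alpha>\<close>, where the two conjugate saddle points merge, the maximum sits on the real
  axis, with value \<open>1 / (\<sigma> powr (- \<alpha>) - 1)\<close> (\<open>kernel_on_line_right\<close>).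

  If \<open>X \<ge> c * n\<close>, a rectangle whose size depends on \<open>c\<close> alone can be chosen such that, up to a
  constant factor, its other three sides contribute no more than this bound of the left side. So a
  bound \<open>m\<close> of the kernel on the line \<open>Re v = \<sigma>\<close> gives
  \<open>\<bar>W\<bar> \<le> const * (m / \<sigma>) * x powr beta_sub \<alpha> \<beta> * m ^ n * exp (- \<sigma> * X)\<close> (\<open>abs_W_le_line\<close>).
  The three uniform estimates are choices of the line: for \<open>x = kappa_bar \<alpha> \<theta> * n powr \<alpha>\<close>
  the line through the saddle points reproduces the stated exponent exactly; below
  \<open>A_bar \<alpha> * n powr \<alpha>\<close> the line through \<open>merge_point \<alpha>\<close> suffices, because
  \<open>1 / 3 \<le> merge_point \<alpha> \<le> 1 / 2\<close>; above it the line is \<open>\<sigma> = \<eta>\<close>, or again \<open>merge_point \<alpha>\<close> if \<open>\<eta>\<close> is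
  smaller. For fixed \<open>x\<close> no lower bound \<open>X \<ge> c * n\<close> is available, but then a rectangle that almost
  fills the half-plane works: on its boundary the kernel is at most \<open>1 / sin \<phi>\<close>, where
  \<open>\<phi> < \<alpha> * pi / 2\<close> is arbitrary, and the room left by \<open>\<epsilon>\<close> absorbs every power of \<open>n\<close>.

  Of the remaining claims, the monotonicity of \<open>kappa_bar\<close> reduces, by the addition formula of the
  cotangent, to a sum of two squares being positive, and the formula for \<open>H\<close> as a maximum says that
  \<open>- ln (\<eta> powr (- \<alpha>) - 1)\<close> crosses its tangent at the inflection point \<open>merge_point \<alpha>\<close>.
\<close>

section \<open>The integral over a rectangle\<close>

text \<open>
  Links the real derivatives in the definition of \<open>W\<close> to the complex ones, to which Cauchy's
  formula applies.
\<close>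

lemma higher_deriv_Re_of_real:
  assumes "open S" "F holomorphic_on S" "open T" "complex_of_real ` T \<subseteq> S"
    and eq: "\<And>t. t \<in> T \<Longrightarrow> f t = Re (F (complex_of_real t))" and "x \<in> T"
  shows "(deriv ^^ n) f x = Re ((deriv ^^ n) F (complex_of_real x))"
  using \<open>x \<in> T\<close>
proof (induction n arbitrary: x)
  case 0
  then show ?case using eq by simp
next
  case (Suc n)
  let ?G = "(deriv ^^ n) F"
  have "?G holomorphic_on S"
    using assms(1,2) by (intro holomorphic_higher_deriv)
  moreover have "complex_of_real x \<in> S" using Suc.prems assms(4) by auto
  ultimately have "(?G has_field_derivative deriv ?G (of_real x)) (at (of_real x))"
    using assms(1) holomorphic_derivI by blast
  hence "((\<lambda>t. ?G (of_real t)) has_vector_derivative deriv ?G (of_real x)) (at x)"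
    by (rule has_vector_derivative_real_field)
  hence "((\<lambda>t. Re (?G (of_real t))) has_real_derivative Re (deriv ?G (of_real x))) (at x)"
    by (simp add: has_vector_derivative_complex_iff)
  moreover have "\<forall>\<^sub>F t in nhds x. (deriv ^^ n) f t = Re (?G (of_real t))"
    using eventually_nhds_in_open[OF \<open>open T\<close> Suc.prems]
    by eventually_elim (rule Suc.IH)
  ultimately have "((deriv ^^ n) f has_real_derivative Re (deriv ?G (of_real x))) (at x)"
    by (subst DERIV_cong_ev[OF refl _ refl])
  then show ?case by (simp add: DERIV_imp_deriv)
qed

lemma rectpath_boundary_cases:
  assumes "v \<in> path_image (rectpath (Complex \<sigma> (-V)) (Complex R V))" "\<sigma> < R" "0 < V"
  shows "(Re v = \<sigma> \<or> Re v = R \<or> \<bar>Im v\<bar> = V) \<and> \<sigma> \<le> Re v \<and> Re v \<le> R \<and> \<bar>Im v\<bar> \<le> V"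
  using assms by (auto simp: path_image_rectpath)

lemma powr_in_halfplane:
  assumes "0 < \<alpha>" "\<alpha> \<le> 1" "0 < Re v"
  shows "0 < Re (v powr complex_of_real \<alpha>)"
proof -
  have "v \<noteq> 0" using assms by auto
  have "\<bar>Im (Ln v)\<bar> < pi / 2" using assms Re_Ln_pos_lt \<open>v \<noteq> 0\<close> by blast
  hence "\<bar>\<alpha> * Im (Ln v)\<bar> < pi / 2"
    using assms mult_left_le_one_le[of "\<bar>Im (Ln v)\<bar>" \<alpha>] by (simp add: abs_mult)
  hence "cos (\<alpha> * Im (Ln v)) > 0" by (intro cos_gt_zero_pi) auto
  thus ?thesis using \<open>v \<noteq> 0\<close> by (simp add: powr_def Re_exp)
qed

lemma powr_eq_1_halfplane:
  assumes "0 < \<alpha>" "\<alpha> \<le> 1" "0 < Re v" "v powr complex_of_real \<alpha> = 1"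
  shows "v = 1"
proof -
  have "v \<noteq> 0" using assms by auto
  have "\<bar>Im (Ln v)\<bar> < pi / 2" using assms Re_Ln_pos_lt \<open>v \<noteq> 0\<close> by blast
  moreover hence "\<bar>\<alpha> * Im (Ln v)\<bar> < pi / 2"
    using assms mult_left_le_one_le[of "\<bar>Im (Ln v)\<bar>" \<alpha>] by (simp add: abs_mult)
  ultimately have "Ln (v powr \<alpha>) = \<alpha> * Ln v"
    by (simp add: powr_def \<open>v \<noteq> 0\<close> abs_less_iff)
  hence "Ln v = 0" using assms by simp
  thus ?thesis using \<open>v \<noteq> 0\<close> by (metis exp_Ln exp_zero)
qed

text \<open>
  The substitution \<open>z = x * v powr \<alpha>\<close> is injective on the right half-plane and stays there, so the
  image of the rectangle is a closed curve in a convex domain. Its shape is irrelevant: its winding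
  number about \<open>x\<close> is the residue of \<open>h' / (h - x)\<close> at the only zero \<open>v = 1\<close> of \<open>h - x\<close>.
\<close>

lemma Cauchy_power_rectangle:
  fixes \<alpha> x \<sigma> R V :: real and h F :: "complex \<Rightarrow> complex"
  defines "h \<equiv> \<lambda>v. complex_of_real x * v powr complex_of_real \<alpha>"
  defines "\<gamma> \<equiv> rectpath (Complex \<sigma> (-V)) (Complex R V)"
  assumes "0 < \<alpha>" "\<alpha> \<le> 1" "0 < x" "0 < \<sigma>" "\<sigma> < 1" "1 < R" "0 < V"
    and F: "F holomorphic_on {z. 0 < Re z}"
  shows "(deriv ^^ n) F (of_real x) / fact n =
    contour_integral \<gamma> (\<lambda>v. \<alpha> * h v / v * (F (h v) / (h v - x) ^ Suc n)) / (2 * pi * \<i>)"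
    and "(\<lambda>v. \<alpha> * h v / v * (F (h v) / (h v - x) ^ Suc n)) contour_integrable_on \<gamma>"
proof -
  let ?H = "{z. 0 < Re z}"
  have opH: "open ?H" by (simp add: open_halfspace_Re_gt)
  have cvH: "convex ?H" by (simp add: convex_halfspace_Re_gt)
  have hder: "(h has_field_derivative (\<alpha> * h v / v)) (at v)" if "0 < Re v" for v
  proof -
    have "v \<notin> \<real>\<^sub>\<le>\<^sub>0" using that by (auto elim!: nonpos_Reals_cases)
    hence "((\<lambda>v. v powr complex_of_real \<alpha>) has_field_derivative
        complex_of_real \<alpha> * v powr (complex_of_real \<alpha> - 1)) (at v)"
      by (rule has_field_derivative_powr)
    hence "(h has_field_derivative of_real x * (\<alpha> * v powr (complex_of_real \<alpha> - 1))) (at v)"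
      unfolding h_def by (rule DERIV_cmult)
    moreover have "v \<noteq> 0" using that by auto
    hence "of_real x * (\<alpha> * v powr (complex_of_real \<alpha> - 1)) = \<alpha> * h v / v"
      by (simp add: h_def powr_diff)
    ultimately show ?thesis by (simp only:)
  qed
  hence hol: "h holomorphic_on ?H"
    unfolding holomorphic_on_open[OF opH] by blast
  hence ana: "h analytic_on ?H" using opH by (simp add: analytic_on_open)
  have dh: "deriv h v = \<alpha> * h v / v" if "0 < Re v" for v
    using DERIV_imp_deriv[OF hder[OF that]] .
  have hH: "0 < Re (h v)" if "0 < Re v" for v
    using powr_in_halfplane[of \<alpha> v] assms that by (simp add: h_def)
  have h1: "h v = x \<longleftrightarrow> v = 1" if "0 < Re v" for v
    using powr_eq_1_halfplane[of \<alpha> v] assms that by (auto simp: h_def)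
  have vp: "valid_path \<gamma>" by (simp add: \<gamma>_def)
  have im: "0 < Re v \<and> v \<noteq> 1" if "v \<in> path_image \<gamma>" for v
    using rectpath_boundary_cases[OF that[unfolded \<gamma>_def]] assms by force
  have imH: "path_image \<gamma> \<subseteq> ?H" using im by auto
  have loop: "pathfinish \<gamma> = pathstart \<gamma>" by (simp add: \<gamma>_def)
  define \<delta> where "\<delta> = h \<circ> \<gamma>"
  have vpd: "valid_path \<delta>" unfolding \<delta>_def
    by (rule valid_path_compose_holomorphic[OF vp hol opH imH])
  have imd: "path_image \<delta> \<subseteq> ?H - {of_real x}"
    unfolding \<delta>_def path_image_compose using im hH h1 by auto
  have loopd: "pathfinish \<delta> = pathstart \<delta>"
    using loop by (simp add: \<delta>_def pathfinish_compose pathstart_compose)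
  have comp: "contour_integral \<delta> g = contour_integral \<gamma> (\<lambda>v. \<alpha> * h v / v * g (h v))" for g
  proof -
    have "contour_integral \<delta> g = contour_integral \<gamma> (\<lambda>w. deriv h w * g (h w))"
      unfolding \<delta>_def by (rule contour_integral_comp_analyticW[OF ana vp imH])
    also have "\<dots> = contour_integral \<gamma> (\<lambda>v. \<alpha> * h v / v * g (h v))"
      by (rule contour_integral_cong) (use im dh in auto)
    finally show ?thesis .
  qed
  have hol1: "(\<lambda>v. \<alpha> * h v / v * (F (h v) / (h v - x) ^ Suc k)) holomorphic_on ?H - {1}"
    if "F holomorphic_on ?H" for F k
  proof -
    have "(F \<circ> h) holomorphic_on ?H"
      by (rule holomorphic_on_compose_gen[OF hol that]) (use hH in auto)
    hence "(F \<circ> h) holomorphic_on ?H - {1}" by (rule holomorphic_on_subset) auto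
    moreover have "h holomorphic_on ?H - {1}" using hol by (rule holomorphic_on_subset) auto
    moreover have "h v \<noteq> x" if "v \<in> ?H - {1}" for v using h1[of v] that by auto
    ultimately show ?thesis
      unfolding comp_def by (intro holomorphic_intros) auto
  qed
  have opH1: "open (?H - {1})" using opH by (simp add: open_delete)
  show "(\<lambda>v. \<alpha> * h v / v * (F (h v) / (h v - x) ^ Suc n)) contour_integrable_on \<gamma>"
    by (rule contour_integrable_holomorphic_simple[OF hol1[OF F] opH1 vp]) (use im in auto)
  have wd: "winding_number \<delta> (of_real x) = 1"
  proof -
    have "contour_integral \<delta> (\<lambda>w. 1 / (w - x)) =
        contour_integral \<gamma> (\<lambda>v. \<alpha> * h v / v * (1 / (h v - x) ^ Suc 0))"
      using comp[of "\<lambda>w. 1 / (w - x)"] by simp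
    also have "\<dots> = 2 * pi * \<i> * (\<Sum>p\<in>{1}. winding_number \<gamma> p *
          residue (\<lambda>v. \<alpha> * h v / v * (1 / (h v - x) ^ Suc 0)) p)"
    proof (rule Residue_theorem)
      show "(\<lambda>v. \<alpha> * h v / v * (1 / (h v - x) ^ Suc 0)) holomorphic_on ?H - {1}"
        using hol1[of "\<lambda>_. 1" 0] by simp
      show "connected ?H" using cvH by (rule convex_connected)
      show "\<forall>z. z \<notin> ?H \<longrightarrow> winding_number \<gamma> z = 0"
        using winding_number_zero_outside[of \<gamma> ?H] vp loop cvH imH valid_path_imp_path by blast
    qed (use opH vp loop im in auto)
    also have "(\<Sum>p\<in>{1}. winding_number \<gamma> p *
          residue (\<lambda>v. \<alpha> * h v / v * (1 / (h v - x) ^ Suc 0)) p) =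
        winding_number \<gamma> 1 * residue (\<lambda>v. \<alpha> * h v / v * (1 / (h v - x) ^ Suc 0)) 1"
      by simp
    also have "winding_number \<gamma> 1 = 1"
      unfolding \<gamma>_def by (rule winding_number_rectpath) (use assms in \<open>auto simp: in_box_complex_iff\<close>)
    also have "residue (\<lambda>v. \<alpha> * h v / v * (1 / (h v - x) ^ Suc 0)) 1 = 1"
    proof (rule residue_simple'[of ?H])
      show "(\<lambda>v. \<alpha> * h v / v * (1 / (h v - x) ^ Suc 0)) holomorphic_on ?H - {1}"
        using hol1[of "\<lambda>_. 1" 0] by simp
      have lim1: "((\<lambda>v. (h v - h 1) / (v - 1)) \<longlongrightarrow> \<alpha> * h 1 / 1) (at 1)"
        using hder[of 1] by (simp add: has_field_derivative_iff)
      have lim2: "((\<lambda>v. \<alpha> * h v / v) \<longlongrightarrow> \<alpha> * h 1 / 1) (at 1)"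
      proof -
        have "isCont h 1" using hder[of 1] DERIV_isCont by fastforce
        thus ?thesis unfolding isCont_def by (intro tendsto_intros) auto
      qed
      have "h 1 = x" by (simp add: h_def)
      have "((\<lambda>v. (\<alpha> * h v / v) / ((h v - x) / (v - 1))) \<longlongrightarrow> (\<alpha> * h 1 / 1) / (\<alpha> * h 1 / 1)) (at 1)"
        using tendsto_divide[OF lim2 lim1] assms \<open>h 1 = x\<close> by simp
      thus "((\<lambda>w. \<alpha> * h w / w * (1 / (h w - x) ^ Suc 0) * (w - 1)) \<longlongrightarrow> 1) (at 1)"
        using assms \<open>h 1 = x\<close> by (simp add: field_simps)
    qed (use opH in auto)
    finally show ?thesis
      using winding_number_valid_path[OF vpd, of "of_real x"] imd by auto
  qed
  have "contour_integral \<delta> (\<lambda>z. F z / (z - x) ^ Suc n) =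
      2 * pi * \<i> * (\<Sum>p\<in>{of_real x}. winding_number \<delta> p * residue (\<lambda>z. F z / (z - x) ^ Suc n) p)"
  proof (rule Residue_theorem)
    show "(\<lambda>z. F z / (z - x) ^ Suc n) holomorphic_on ?H - {of_real x}"
      by (intro holomorphic_intros holomorphic_on_subset[OF F]) auto
    show "connected ?H" using cvH by (rule convex_connected)
    show "\<forall>z. z \<notin> ?H \<longrightarrow> winding_number \<delta> z = 0"
      using winding_number_zero_outside[of \<delta> ?H] vpd loopd cvH imd valid_path_imp_path by blast
  qed (use opH vpd loopd imd in auto)
  also have "(\<Sum>p\<in>{of_real x}. winding_number \<delta> p * residue (\<lambda>z. F z / (z - x) ^ Suc n) p) =
      residue (\<lambda>z. F z / (z - x) ^ Suc n) (of_real x)"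
    by (simp add: wd)
  also have "residue (\<lambda>z. F z / (z - x) ^ Suc n) (of_real x) = (deriv ^^ n) F (of_real x) / fact n"
    by (rule residue_holomorphic_over_power[OF opH _ F]) (use assms in auto)
  finally show "(deriv ^^ n) F (of_real x) / fact n =
    contour_integral \<gamma> (\<lambda>v. \<alpha> * h v / v * (F (h v) / (h v - x) ^ Suc n)) / (2 * pi * \<i>)"
    by (simp add: comp)
qed

lemma norm_contour_integral_rectpath_le:
  assumes "f contour_integrable_on rectpath a b" "Re a \<le> Re b" "Im a \<le> Im b" "0 \<le> B"
    and B: "\<And>v. v \<in> path_image (rectpath a b) \<Longrightarrow> norm (f v) \<le> B"
  shows "norm (contour_integral (rectpath a b) f) \<le> B * (2 * (Re b - Re a) + 2 * (Im b - Im a))"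
proof -
  define a2 a4 where "a2 = Complex (Re b) (Im a)" and "a4 = Complex (Re a) (Im b)"
  note rp = rectpath_def[of a b, unfolded Let_def, folded a2_def a4_def]
  have int: "f contour_integrable_on linepath a a2" "f contour_integrable_on linepath a2 b"
    "f contour_integrable_on linepath b a4" "f contour_integrable_on linepath a4 a"
    using assms(1) unfolding rp by (auto simp: contour_integrable_join)
  have img: "path_image (rectpath a b) =
      closed_segment a a2 \<union> closed_segment a2 b \<union> closed_segment b a4 \<union> closed_segment a4 a"
    unfolding rp by (simp add: path_image_join Un_assoc)
  have "contour_integral (rectpath a b) f = contour_integral (linepath a a2) f +
      (contour_integral (linepath a2 b) f + (contour_integral (linepath b a4) f +
       contour_integral (linepath a4 a) f))"
    unfolding rp using int by (simp add: contour_integrable_joinI)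
  hence "norm (contour_integral (rectpath a b) f) \<le> norm (contour_integral (linepath a a2) f) +
      (norm (contour_integral (linepath a2 b) f) + (norm (contour_integral (linepath b a4) f) +
       norm (contour_integral (linepath a4 a) f)))"
    by (simp only:) (intro norm_triangle_le add_mono order_refl)
  also have "\<dots> \<le> B * norm (a2 - a) + (B * norm (b - a2) + (B * norm (a4 - b) + B * norm (a - a4)))"
    using int assms(4) B unfolding img
    by (intro add_mono contour_integral_bound_linepath) auto
  finally have "norm (contour_integral (rectpath a b) f) \<le>
      B * norm (a2 - a) + (B * norm (b - a2) + (B * norm (a4 - b) + B * norm (a - a4)))" .
  moreover have "norm (a2 - a) = Re b - Re a" "norm (a4 - b) = Re b - Re a"
    "norm (b - a2) = Im b - Im a" "norm (a - a4) = Im b - Im a"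
    using assms by (auto simp: a2_def a4_def cmod_def)
  ultimately show ?thesis by (simp add: algebra_simps)
qed

lemma beta_bar_eq: "0 < \<alpha> \<Longrightarrow> beta_bar \<alpha> \<beta> = \<alpha> * \<beta> - \<alpha> + 1"
  by (simp add: beta_bar_def beta_sub_def algebra_simps)

text \<open>
  The powers multiply without a branch jump because \<open>\<bar>Arg v\<bar> < pi / 2\<close> and \<open>\<alpha> \<le> 1\<close>.
\<close>

lemma powr_scaled:
  assumes "0 < \<alpha>" "\<alpha> \<le> 1" "0 < x" "0 < Re v"
  shows "(complex_of_real x * v powr complex_of_real \<alpha>) powr complex_of_real s =
    complex_of_real (x powr s) * v powr complex_of_real (\<alpha> * s)"
proof -
  have v: "v \<noteq> 0" using assms by auto
  have "\<bar>Im (Ln v)\<bar> < pi / 2" using assms Re_Ln_pos_lt_imp by blast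
  hence "\<bar>\<alpha> * Im (Ln v)\<bar> < pi / 2"
    using assms mult_left_le_one_le[of "\<bar>Im (Ln v)\<bar>" \<alpha>] by (simp add: abs_mult)
  hence "Ln (v powr \<alpha>) = \<alpha> * Ln v"
    by (simp add: powr_def v abs_less_iff)
  hence "Ln (complex_of_real x * v powr \<alpha>) = of_real (ln x) + \<alpha> * Ln v"
    using assms v by (simp add: Ln_times_of_real Ln_of_real)
  thus ?thesis using assms v
    by (simp add: powr_def exp_add[symmetric] exp_of_real[symmetric] algebra_simps)
qed

text \<open>
  The only facts about \<open>e_dens\<close> that matter are the moduli of its factors at \<open>x * v powr \<alpha>\<close>: the
  exponential becomes \<open>exp (- X * v)\<close>, and all powers of \<open>v\<close> combine to \<open>beta_bar \<alpha> \<beta> - 1\<close>.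
\<close>

lemma abs_W_le_rectangle:
  fixes \<alpha> \<beta> x \<sigma> R V M :: real
  assumes "0 < \<alpha>" "\<alpha> \<le> 1" "1 - 1 / \<alpha> \<le> \<beta>" "0 < x" "0 < \<sigma>" "\<sigma> < 1" "1 < R" "0 < V" "0 \<le> M"
    and M: "\<And>v. \<sigma> \<le> Re v \<Longrightarrow> Re v \<le> R \<Longrightarrow> \<bar>Im v\<bar> \<le> V \<Longrightarrow>
        Re v = \<sigma> \<or> Re v = R \<or> \<bar>Im v\<bar> = V \<Longrightarrow>
        norm v powr (beta_bar \<alpha> \<beta> - 1) * (norm (v powr \<alpha>) / norm (v powr \<alpha> - 1)) ^ Suc n
          * exp (- (x powr (1 / \<alpha>)) * Re v) \<le> M"
  shows "\<bar>W \<alpha> \<beta> n x\<bar> \<le> x powr beta_sub \<alpha> \<beta> * M * (R + 2 * V) / Gamma (\<alpha> * \<beta> + 1)"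
proof -
  note basic = assms(1-9)
  let ?H = "{z. 0 < Re z}"
  define b where "b = beta_sub \<alpha> \<beta>"
  define G where "G = Gamma (\<alpha> * \<beta> + 1)"
  define X where "X = x powr (1 / \<alpha>)"
  have "\<alpha> * (1 - 1 / \<alpha>) \<le> \<alpha> * \<beta>" using basic by (intro mult_left_mono) auto
  hence "\<alpha> * \<beta> + 1 > 0" using basic by (simp add: algebra_simps)
  hence G: "G > 0" by (simp add: G_def)
  define F where "F = (\<lambda>z::complex. z ^ n * (z powr complex_of_real b *
      exp (- (z powr complex_of_real (1 / \<alpha>))) / complex_of_real (\<alpha> * G)))"
  have holF: "F holomorphic_on ?H"
    unfolding F_def using basic G by (intro holomorphic_intros) (auto elim!: nonpos_Reals_cases)
  have "(deriv ^^ n) (\<lambda>t. t ^ n * e_dens \<alpha> \<beta> t) x = Re ((deriv ^^ n) F (complex_of_real x))"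
  proof (rule higher_deriv_Re_of_real[OF _ holF, of "{0<..}"])
    fix t :: real assume "t \<in> {0<..}"
    hence "t > 0" by simp
    have p: "complex_of_real t powr complex_of_real s = complex_of_real (t powr s)" for s
      using \<open>t > 0\<close> by (simp add: powr_of_real)
    have "F (complex_of_real t) = complex_of_real (t ^ n) *
        (complex_of_real (t powr b) * complex_of_real (exp (- (t powr (1 / \<alpha>)))) / complex_of_real (\<alpha> * G))"
      unfolding F_def p by (simp only: of_real_power exp_of_real[symmetric] of_real_minus)
    also have "\<dots> = complex_of_real (t ^ n * e_dens \<alpha> \<beta> t)"
      by (simp add: e_dens_def b_def beta_sub_def G_def)
    finally have "F (complex_of_real t) = complex_of_real (t ^ n * e_dens \<alpha> \<beta> t)" .
    thus "t ^ n * e_dens \<alpha> \<beta> t = Re (F (complex_of_real t))" by simp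
  qed (use basic in \<open>auto simp: open_halfspace_Re_gt\<close>)
  hence WF: "W \<alpha> \<beta> n x = Re ((deriv ^^ n) F (complex_of_real x) / fact n)"
    using Re_divide_of_real[of "(deriv ^^ n) F (complex_of_real x)" "fact n"]
    by (simp only: W_def of_real_fact)
  define h where "h = (\<lambda>v. complex_of_real x * v powr complex_of_real \<alpha>)"
  define \<gamma> where "\<gamma> = rectpath (Complex \<sigma> (-V)) (Complex R V)"
  let ?I = "\<lambda>v. \<alpha> * h v / v * (F (h v) / (h v - x) ^ Suc n)"
  have C: "(deriv ^^ n) F (of_real x) / fact n = contour_integral \<gamma> ?I / (2 * pi * \<i>)"
    "?I contour_integrable_on \<gamma>"
    unfolding h_def \<gamma>_def by (rule Cauchy_power_rectangle[OF basic(1,2,4-8) holF])+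
  have bd: "norm (?I v) \<le> x powr b * M / G" if "v \<in> path_image \<gamma>" for v
  proof -
    have mem: "(Re v = \<sigma> \<or> Re v = R \<or> \<bar>Im v\<bar> = V)" "\<sigma> \<le> Re v" "Re v \<le> R" "\<bar>Im v\<bar> \<le> V"
      using rectpath_boundary_cases[OF that[unfolded \<gamma>_def]] assms by auto
    have rv: "Re v > 0" using mem assms by linarith
    hence v: "v \<noteq> 0" "norm v > 0" by auto
    define w where "w = v powr complex_of_real \<alpha>"
    have hw: "h v = x * w" "h v - x = x * (w - 1)" by (simp_all add: h_def w_def algebra_simps)
    have pb: "h v powr complex_of_real b = of_real (x powr b) * v powr of_real (\<alpha> * b)"
      unfolding h_def by (rule powr_scaled) (use basic rv in auto)
    have pX: "h v powr of_real (1 / \<alpha>) = of_real X * v"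
      using powr_scaled[of \<alpha> x v "1 / \<alpha>"] assms rv v by (simp add: h_def X_def)
    have nb: "norm (v powr of_real (\<alpha> * b)) = norm v powr beta_bar \<alpha> \<beta>"
      by (simp add: norm_powr_real_powr' beta_bar_def b_def del: of_real_mult)
    have nh1: "norm (h v) = x * norm w"
      unfolding hw(1) using basic by (simp only: norm_mult norm_of_real abs_of_pos)
    have nh2: "norm (h v - x) = x * norm (w - 1)"
      unfolding hw(2) using basic by (simp only: norm_mult norm_of_real abs_of_pos)
    note nh = nh1 nh2
    have nF: "norm (F (h v)) = (x * norm w) ^ n *
        (x powr b * norm v powr beta_bar \<alpha> \<beta> * exp (- X * Re v) / (\<alpha> * G))"
      unfolding F_def pb pX using basic G
      by (simp add: norm_mult norm_divide norm_power nh nb del: of_real_mult)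
    have "norm (?I v) = \<alpha> * norm (h v) / norm v * (norm (F (h v)) / norm (h v - x) ^ Suc n)"
      using basic by (simp only: norm_mult norm_divide norm_power norm_of_real abs_of_pos)
    also have "\<dots> = \<alpha> * (x * norm w) / norm v * ((x * norm w) ^ n *
        (x powr b * norm v powr beta_bar \<alpha> \<beta> * exp (- X * Re v) / (\<alpha> * G)) / (x * norm (w - 1)) ^ Suc n)"
      by (simp only: nh nF)
    also have "\<dots> = x powr b / G * (norm v powr beta_bar \<alpha> \<beta> / norm v * (norm w / norm (w - 1)) ^ Suc n * exp (- X * Re v))"
      using basic G v by (simp add: field_simps power_divide power_mult_distrib)
    also have "norm v powr beta_bar \<alpha> \<beta> / norm v = norm v powr (beta_bar \<alpha> \<beta> - 1)"
      using v by (simp add: powr_diff)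
    also have "x powr b / G * (norm v powr (beta_bar \<alpha> \<beta> - 1) * (norm w / norm (w - 1)) ^ Suc n * exp (- X * Re v))
        \<le> x powr b / G * M"
      using M[of v] mem G unfolding w_def X_def by (intro mult_left_mono) auto
    finally show ?thesis by simp
  qed
  have nn: "x powr b * M / G \<ge> 0" using basic G by simp
  have "\<bar>W \<alpha> \<beta> n x\<bar> \<le> norm ((deriv ^^ n) F (complex_of_real x) / fact n)"
    unfolding WF by (rule abs_Re_le_cmod)
  also have "\<dots> = norm (contour_integral \<gamma> ?I) / (2 * pi)"
    unfolding C(1) by (simp add: norm_divide norm_mult)
  also have "norm (contour_integral \<gamma> ?I) \<le> x powr b * M / G * (2 * (R - \<sigma>) + 2 * (V - - V))"
    using norm_contour_integral_rectpath_le[OF C(2)[unfolded \<gamma>_def], of "x powr b * M / G"]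
      bd[unfolded \<gamma>_def] nn basic by (simp add: \<gamma>_def)
  also have "\<dots> \<le> x powr b * M / G * ((R + 2 * V) * (2 * pi))"
  proof (rule mult_left_mono[OF _ nn])
    have "(R + 2 * V) * 2 \<le> (R + 2 * V) * (2 * pi)"
      using basic pi_gt3 by (intro mult_left_mono) auto
    thus "2 * (R - \<sigma>) + 2 * (V - - V) \<le> (R + 2 * V) * (2 * pi)" using basic by simp
  qed
  finally have "\<bar>W \<alpha> \<beta> n x\<bar> \<le> x powr b * M / G * ((R + 2 * V) * (2 * pi)) / (2 * pi)"
    by (simp add: divide_right_mono)
  thus ?thesis by (simp add: b_def G_def mult.assoc)
qed

section \<open>The kernel on a vertical line\<close>

lemma x_cos_le_sin:
  fixes t :: real
  assumes "0 \<le> t" "t \<le> pi"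
  shows "t * cos t \<le> sin t"
proof -
  have "sin 0 - 0 * cos 0 \<le> sin t - t * cos t"
  proof (rule DERIV_nonneg_imp_nondecreasing[where f = "\<lambda>u. sin u - u * cos u"])
    fix u assume u: "0 \<le> u" "u \<le> t"
    have "((\<lambda>u. sin u - u * cos u) has_real_derivative (u * sin u)) (at u)"
      by (auto intro!: derivative_eq_intros)
    moreover have "u * sin u \<ge> 0" using u assms by (intro mult_nonneg_nonneg sin_ge_zero) auto
    ultimately show "\<exists>y. ((\<lambda>u. sin u - u * cos u) has_real_derivative y) (at u) \<and> 0 \<le> y" by blast
  qed (use assms in auto)
  thus ?thesis by simp
qed

text \<open>
  The second derivative is \<open>- 2 * (sin t - t * cos t) / (sin t) ^ 3\<close>.
\<close>

lemma concave_x_cot_x: "concave_on {0<..<pi} (\<lambda>t::real. t * (cos t / sin t))"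
proof (rule f''_le0_imp_concave)
  fix t :: real assume t: "t \<in> {0<..<pi}"
  have s: "sin t > 0" using t by (intro sin_gt_zero) auto
  show "((\<lambda>t. t * (cos t / sin t)) has_real_derivative (cos t / sin t - t / (sin t)\<^sup>2)) (at t)"
  proof -
    have "((\<lambda>t. t * (cos t / sin t)) has_real_derivative
        (t * ((- sin t * sin t - cos t * cos t) / (sin t * sin t)) + 1 * (cos t / sin t))) (at t)"
      using s by (auto intro!: derivative_eq_intros simp: field_simps)
    moreover have "- sin t * sin t - cos t * cos t = -1"
      using sin_cos_squared_add[of t] by (simp add: power2_eq_square)
    ultimately show ?thesis using s by (simp add: power2_eq_square)
  qed
  show "((\<lambda>t. cos t / sin t - t / (sin t)\<^sup>2) has_real_derivative
      (-2 * (sin t - t * cos t) / sin t ^ 3)) (at t)"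
  proof -
    have "((\<lambda>t. cos t / sin t - t / (sin t)\<^sup>2) has_real_derivative
        ((- sin t * sin t - cos t * cos t) / (sin t * sin t)
          - (1 * (sin t)\<^sup>2 - t * (2 * sin t * cos t)) / ((sin t)\<^sup>2 * (sin t)\<^sup>2))) (at t)"
      using s by (auto intro!: derivative_eq_intros simp: power2_eq_square)
    moreover have "- sin t * sin t - cos t * cos t = -1"
      using sin_cos_squared_add[of t] by (simp add: power2_eq_square)
    moreover have "- 1 / (sin t * sin t)
        - (1 * (sin t)\<^sup>2 - t * (2 * sin t * cos t)) / ((sin t)\<^sup>2 * (sin t)\<^sup>2)
      = -2 * (sin t - t * cos t) / sin t ^ 3"
      using s by (simp add: field_simps power2_eq_square power3_eq_cube)
    ultimately show ?thesis by (simp only:)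
  qed
  have "t * cos t \<le> sin t" by (rule x_cos_le_sin) (use t in auto)
  thus "-2 * (sin t - t * cos t) / sin t ^ 3 \<le> 0"
    using s by (simp add: divide_nonpos_pos)
qed (simp add: convex_real_interval)

text \<open>
  Concavity of \<open>t * cot t\<close> between \<open>\<psi>\<close> and \<open>2 * \<psi>\<close>, where \<open>(1 + \<alpha>) * \<psi>\<close> is the point with weight \<open>\<alpha>\<close>,
  together with \<open>2 * cot (2 * \<psi>) = cot \<psi> - tan \<psi>\<close>. Equality holds for \<open>\<alpha> = 1\<close>.
\<close>

lemma cot_le_cot_mult_add_tan:
  fixes \<alpha> \<psi> :: real
  assumes "0 < \<alpha>" "\<alpha> \<le> 1" "0 < \<psi>" "\<psi> < pi / 2"
  shows "cos \<psi> / sin \<psi> \<le> (1 + \<alpha>) * (cos ((1 + \<alpha>) * \<psi>) / sin ((1 + \<alpha>) * \<psi>)) + \<alpha> * (sin \<psi> / cos \<psi>)"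
proof -
  let ?g = "\<lambda>t::real. t * (cos t / sin t)"
  have s: "sin \<psi> > 0" "cos \<psi> > 0" using assms by (auto intro!: sin_gt_zero cos_gt_zero)
  have "(1 - \<alpha>) * ?g \<psi> + \<alpha> * ?g (2 * \<psi>) \<le> ?g ((1 - \<alpha>) *\<^sub>R \<psi> + \<alpha> *\<^sub>R (2 * \<psi>))"
    using concave_onD[OF concave_x_cot_x, of \<alpha> \<psi> "2 * \<psi>"] assms by auto
  also have "(1 - \<alpha>) *\<^sub>R \<psi> + \<alpha> *\<^sub>R (2 * \<psi>) = (1 + \<alpha>) * \<psi>" by (simp add: algebra_simps)
  finally have "\<psi> * ((1 - \<alpha>) * (cos \<psi> / sin \<psi>) + 2 * \<alpha> * (cos (2 * \<psi>) / sin (2 * \<psi>)))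
      \<le> \<psi> * ((1 + \<alpha>) * (cos ((1 + \<alpha>) * \<psi>) / sin ((1 + \<alpha>) * \<psi>)))"
    by (simp add: algebra_simps)
  hence "(1 - \<alpha>) * (cos \<psi> / sin \<psi>) + 2 * \<alpha> * (cos (2 * \<psi>) / sin (2 * \<psi>))
      \<le> (1 + \<alpha>) * (cos ((1 + \<alpha>) * \<psi>) / sin ((1 + \<alpha>) * \<psi>))"
    using assms(3) by (rule mult_left_le_imp_le)
  moreover have "2 * (cos (2 * \<psi>) / sin (2 * \<psi>)) = cos \<psi> / sin \<psi> - sin \<psi> / cos \<psi>"
    unfolding cos_double sin_double using s by (simp add: field_simps power2_eq_square)
  hence "2 * \<alpha> * (cos (2 * \<psi>) / sin (2 * \<psi>)) = \<alpha> * (cos \<psi> / sin \<psi> - sin \<psi> / cos \<psi>)"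
    by (metis mult.assoc mult.commute)
  moreover have "(1 - \<alpha>) * (cos \<psi> / sin \<psi>) = cos \<psi> / sin \<psi> - \<alpha> * (cos \<psi> / sin \<psi>)"
    by (rule left_diff_distrib [THEN trans]) simp
  ultimately show ?thesis by (simp only: right_diff_distrib)
qed

lemma scaled_angle:
  fixes \<alpha> t :: real
  assumes "0 < \<alpha>" "\<alpha> \<le> 1" "0 < t" "t < pi / 2"
  shows "0 < \<alpha> * t" "\<alpha> * t \<le> t" "\<alpha> * t < pi / 2" "\<alpha> * t < pi"
proof -
  show "0 < \<alpha> * t" using assms by simp
  show 1: "\<alpha> * t \<le> t" using assms by (simp add: mult_left_le_one_le)
  show "\<alpha> * t < pi / 2" "\<alpha> * t < pi" using 1 assms by linarith+
qed

lemma sin_add_one_pos: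
  fixes \<alpha> \<psi> :: real
  assumes "0 < \<alpha>" "\<alpha> \<le> 1" "0 < \<psi>" "\<psi> < pi / 2"
  shows "0 < sin ((1 + \<alpha>) * \<psi>)"
proof (rule sin_gt_zero)
  have "(1 + \<alpha>) * \<psi> \<le> 2 * \<psi>" using assms by (intro mult_right_mono) auto
  thus "(1 + \<alpha>) * \<psi> < pi" using assms by linarith
qed (use assms in auto)

text \<open>
  As \<open>X / n\<close> varies, the saddle points of \<open>(v powr \<alpha> / (v powr \<alpha> - 1)) ^ n * exp (- X * v)\<close> sweep out
  the points where \<open>v - v powr (1 + \<alpha>)\<close> is real and positive. The one with argument \<open>\<psi>\<close> has real
  part \<open>\<sigma>\<close> with \<open>\<sigma> powr \<alpha> = saddle_locus \<alpha> \<psi>\<close>.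
\<close>

definition saddle_locus :: "real \<Rightarrow> real \<Rightarrow> real" where
  "saddle_locus \<alpha> \<psi> = cos \<psi> powr \<alpha> * sin \<psi> / sin ((1 + \<alpha>) * \<psi>)"

text \<open>
  The logarithmic derivative is \<open>cot \<psi> - (1 + \<alpha>) * cot ((1 + \<alpha>) * \<psi>) - \<alpha> * tan \<psi>\<close>.
\<close>

lemma saddle_locus_antimono:
  assumes "0 < \<alpha>" "\<alpha> \<le> 1" "0 < \<theta>" "\<theta> \<le> \<psi>" "\<psi> < pi / 2"
  shows "saddle_locus \<alpha> \<psi> \<le> saddle_locus \<alpha> \<theta>"
proof -
  let ?l = "\<lambda>t. \<alpha> * ln (cos t) + ln (sin t) - ln (sin ((1 + \<alpha>) * t))"
  have pos: "cos t > 0" "sin t > 0" "sin ((1 + \<alpha>) * t) > 0" if "0 < t" "t < pi / 2" for t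
    using that assms sin_add_one_pos[of \<alpha> t] by (auto intro!: sin_gt_zero cos_gt_zero)
  have eq: "saddle_locus \<alpha> t = exp (?l t)" if "0 < t" "t < pi / 2" for t
    using pos[OF that] by (simp add: saddle_locus_def exp_add exp_diff powr_def)
  have "?l \<psi> \<le> ?l \<theta>"
  proof (rule DERIV_nonpos_imp_nonincreasing[OF \<open>\<theta> \<le> \<psi>\<close>])
    fix t assume t: "\<theta> \<le> t" "t \<le> \<psi>"
    hence t': "0 < t" "t < pi / 2" using assms by auto
    have "(?l has_real_derivative (\<alpha> * (- sin t / cos t) + cos t / sin t
        - (1 + \<alpha>) * (cos ((1 + \<alpha>) * t) / sin ((1 + \<alpha>) * t)))) (at t)"
      using pos[OF t'] by (auto intro!: derivative_eq_intros simp: field_simps)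
    moreover have "\<alpha> * (- sin t / cos t) + cos t / sin t
        - (1 + \<alpha>) * (cos ((1 + \<alpha>) * t) / sin ((1 + \<alpha>) * t)) \<le> 0"
      using cot_le_cot_mult_add_tan[of \<alpha> t] assms t' by simp
    ultimately show "\<exists>y. (?l has_real_derivative y) (at t) \<and> y \<le> 0" by blast
  qed
  thus ?thesis using eq[of \<theta>] eq[of \<psi>] assms by simp
qed

text \<open>
  The bound is the limit at \<open>0\<close>, the point where the two conjugate saddle points merge.
\<close>

lemma saddle_locus_le:
  assumes "0 < \<alpha>" "\<alpha> \<le> 1" "0 < \<psi>" "\<psi> < pi / 2"
  shows "saddle_locus \<alpha> \<psi> \<le> 1 / (1 + \<alpha>)"
proof (rule tendsto_lowerbound)
  have "((\<lambda>t::real. cos t powr \<alpha> * (sin t / sin ((1 + \<alpha>) * t))) \<longlongrightarrow> 1 powr \<alpha> * (1 / (1 + \<alpha>))) (at_right 0)"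
  proof (rule tendsto_mult)
    show "((\<lambda>t::real. cos t powr \<alpha>) \<longlongrightarrow> 1 powr \<alpha>) (at_right 0)"
      by (auto intro!: tendsto_eq_intros)
    have "1 + \<alpha> > 0" using assms by simp
    then show "((\<lambda>t::real. sin t / sin ((1 + \<alpha>) * t)) \<longlongrightarrow> 1 / (1 + \<alpha>)) (at_right 0)"
      unfolding inverse_eq_divide [symmetric] by real_asymp
  qed
  thus "(saddle_locus \<alpha> \<longlongrightarrow> 1 / (1 + \<alpha>)) (at_right 0)"
    by (simp add: saddle_locus_def[abs_def])
  show "\<forall>\<^sub>F t in at_right 0. saddle_locus \<alpha> \<psi> \<le> saddle_locus \<alpha> t"
    using eventually_at_right_real[OF assms(3)]
    by eventually_elim (use saddle_locus_antimono[of \<alpha> _ \<psi>] assms in auto)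
qed auto

text \<open>
  At the point of the line \<open>Re v = \<sigma>\<close> with argument \<open>\<psi>\<close>, the number \<open>s \<psi>\<close> is \<open>\<bar>v\<bar> powr (- \<alpha>)\<close>, so the
  differentiated function is \<open>\<bar>1 - v powr (- \<alpha>)\<bar>\<^sup>2\<close>, the inverse square of the kernel.
\<close>

lemma line_kernel_deriv:
  fixes \<alpha> \<sigma> :: real
  assumes "0 < \<sigma>" "0 \<le> \<psi>" "\<psi> < pi / 2"
  defines "s \<equiv> \<lambda>t. (cos t / \<sigma>) powr \<alpha>"
  shows "((\<lambda>t. 1 - 2 * s t * cos (\<alpha> * t) + (s t)\<^sup>2) has_real_derivative
    2 * \<alpha> * s \<psi> / cos \<psi> * (sin ((1 + \<alpha>) * \<psi>) - s \<psi> * sin \<psi>)) (at \<psi>)"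
proof -
  have c: "cos \<psi> > 0" using assms by (intro cos_gt_zero_pi) auto
  have ds: "(s has_real_derivative - \<alpha> * (sin \<psi> / cos \<psi>) * s \<psi>) (at \<psi>)"
    unfolding s_def using c assms(1)
    by (auto intro!: derivative_eq_intros simp: powr_diff)
  have "((\<lambda>t. 1 - 2 * s t * cos (\<alpha> * t) + (s t)\<^sup>2) has_real_derivative
     0 - (2 * (- \<alpha> * (sin \<psi> / cos \<psi>) * s \<psi>) * cos (\<alpha> * \<psi>) + (- sin (\<alpha> * \<psi>) * \<alpha>) * (2 * s \<psi>))
       + 2 * s \<psi> * (- \<alpha> * (sin \<psi> / cos \<psi>) * s \<psi>)) (at \<psi>)"
    by ((rule derivative_eq_intros ds refl | simp)+, simp add: algebra_simps)
  moreover have "0 - (2 * (- \<alpha> * (sin \<psi> / cos \<psi>) * s \<psi>) * cos (\<alpha> * \<psi>) + (- sin (\<alpha> * \<psi>) * \<alpha>) * (2 * s \<psi>))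
       + 2 * s \<psi> * (- \<alpha> * (sin \<psi> / cos \<psi>) * s \<psi>) =
     2 * \<alpha> * s \<psi> / cos \<psi> * (sin ((1 + \<alpha>) * \<psi>) - s \<psi> * sin \<psi>)"
  proof -
    define u where "u = sin \<psi> / cos \<psi>"
    have "sin \<psi> = u * cos \<psi>" using c by (simp add: u_def)
    have "sin ((1 + \<alpha>) * \<psi>) = sin \<psi> * cos (\<alpha> * \<psi>) + cos \<psi> * sin (\<alpha> * \<psi>)"
      by (simp add: distrib_right sin_add)
    hence eq: "sin ((1 + \<alpha>) * \<psi>) - s \<psi> * sin \<psi> =
        cos \<psi> * (u * cos (\<alpha> * \<psi>) + sin (\<alpha> * \<psi>) - s \<psi> * u)"
      unfolding \<open>sin \<psi> = u * cos \<psi>\<close> by (simp add: algebra_simps)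
    show ?thesis
      unfolding u_def[symmetric] eq using c by (simp add: power2_eq_square algebra_simps)
  qed
  ultimately show ?thesis by (simp only:)
qed

lemma line_kernel_sign:
  fixes \<alpha> \<sigma> \<psi> :: real
  assumes "0 < \<alpha>" "\<alpha> \<le> 1" "0 < \<sigma>" "0 < \<psi>" "\<psi> < pi / 2"
  shows "saddle_locus \<alpha> \<psi> \<le> \<sigma> powr \<alpha> \<longleftrightarrow> (cos \<psi> / \<sigma>) powr \<alpha> * sin \<psi> \<le> sin ((1 + \<alpha>) * \<psi>)"
proof -
  have "cos \<psi> > 0" "0 < sin ((1 + \<alpha>) * \<psi>)"
    using assms sin_add_one_pos[of \<alpha> \<psi>] by (auto intro!: cos_gt_zero)
  thus ?thesis using assms(3)
    by (simp add: saddle_locus_def powr_divide pos_divide_le_eq mult.commute)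
qed

text \<open>
  The derivative along the line changes sign where the line crosses the locus of the saddle points;
  \<open>\<theta> = 0\<close> covers the lines that do not meet it.
\<close>

lemma line_kernel_min:
  fixes \<alpha> \<sigma> \<theta> \<psi> :: real
  assumes "0 < \<alpha>" "\<alpha> \<le> 1" "0 < \<sigma>" "0 \<le> \<psi>" "\<psi> < pi / 2" "0 \<le> \<theta>" "\<theta> < pi / 2"
    and below: "\<And>t. 0 < t \<Longrightarrow> t < \<theta> \<Longrightarrow> \<sigma> powr \<alpha> \<le> saddle_locus \<alpha> t"
    and above: "\<And>t. \<theta> < t \<Longrightarrow> t < pi / 2 \<Longrightarrow> saddle_locus \<alpha> t \<le> \<sigma> powr \<alpha>"
  defines "s \<equiv> \<lambda>t. (cos t / \<sigma>) powr \<alpha>"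
  shows "1 - 2 * s \<theta> * cos (\<alpha> * \<theta>) + (s \<theta>)\<^sup>2 \<le> 1 - 2 * s \<psi> * cos (\<alpha> * \<psi>) + (s \<psi>)\<^sup>2"
proof -
  let ?q = "\<lambda>t. 1 - 2 * s t * cos (\<alpha> * t) + (s t)\<^sup>2"
  let ?d = "\<lambda>t. 2 * \<alpha> * s t / cos t * (sin ((1 + \<alpha>) * t) - s t * sin t)"
  have der: "(?q has_real_derivative ?d t) (at t)" if "0 \<le> t" "t < pi / 2" for t
    unfolding s_def by (rule line_kernel_deriv[OF assms(3) that])
  have pre: "2 * \<alpha> * s t / cos t \<ge> 0" if "0 \<le> t" "t < pi / 2" for t
  proof -
    have "cos t > 0" using that by (intro cos_gt_zero_pi) auto
    thus ?thesis using assms by (simp add: s_def)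
  qed
  show ?thesis
  proof (cases "\<theta> \<le> \<psi>")
    case True
    show ?thesis
    proof (rule DERIV_nonneg_imp_increasing_open[OF True])
      fix t assume t: "\<theta> < t" "t < \<psi>"
      hence "s t * sin t \<le> sin ((1 + \<alpha>) * t)"
        using above[of t] line_kernel_sign[of \<alpha> \<sigma> t] assms by (auto simp: s_def)
      hence "?d t \<ge> 0" using pre[of t] t assms by (intro mult_nonneg_nonneg) auto
      thus "\<exists>y. (?q has_real_derivative y) (at t) \<and> 0 \<le> y" using der[of t] t assms by auto
    next
      show "continuous_on {\<theta>..\<psi>} ?q"
        by (rule DERIV_continuous_on, rule has_field_derivative_at_within, rule der) (use assms in auto)
    qed
  next
    case False
    hence le: "\<psi> \<le> \<theta>" by simp
    show ?thesis
    proof (rule DERIV_nonpos_imp_decreasing_open[OF le])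
      fix t assume t: "\<psi> < t" "t < \<theta>"
      have "cos t > 0" "0 < sin ((1 + \<alpha>) * t)"
        using t assms sin_add_one_pos[of \<alpha> t] by (auto intro!: cos_gt_zero)
      hence "sin ((1 + \<alpha>) * t) \<le> s t * sin t"
        using below[of t] t assms
        by (simp add: s_def saddle_locus_def powr_divide field_simps)
      hence "?d t \<le> 0" using pre[of t] t assms by (intro mult_nonneg_nonpos) auto
      thus "\<exists>y. (?q has_real_derivative y) (at t) \<and> y \<le> 0" using der[of t] t assms by auto
    next
      show "continuous_on {\<psi>..\<theta>} ?q"
        by (rule DERIV_continuous_on, rule has_field_derivative_at_within, rule der) (use assms in auto)
    qed
  qed
qed

lemma norm_powr_minus_one_polar:
  fixes \<alpha> :: real and v :: complex
  assumes "0 < Re v"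
  defines "\<psi> \<equiv> \<bar>Im (Ln v)\<bar>" and "s \<equiv> (cos \<bar>Im (Ln v)\<bar> / Re v) powr \<alpha>"
  shows "(norm (v powr \<alpha> - 1))\<^sup>2 = (norm (v powr \<alpha>))\<^sup>2 * (1 - 2 * s * cos (\<alpha> * \<psi>) + s\<^sup>2)"
    and "0 \<le> \<psi>" "\<psi> < pi / 2"
proof -
  have v: "v \<noteq> 0" using assms(1) by auto
  show "0 \<le> \<psi>" by (simp add: \<psi>_def)
  show "\<psi> < pi / 2" using assms(1) Re_Ln_pos_lt_imp by (simp add: \<psi>_def)
  define r where "r = norm v"
  define t where "t = Im (Ln v)"
  have r: "r > 0" using v by (simp add: r_def)
  have "exp (Ln v) = v" using v by simp
  hence "Re v = r * cos t" using v
    by (metis Re_exp Re_Ln exp_ln r r_def t_def)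
  hence cs: "cos \<psi> / Re v = inverse r"
    using assms(1) by (cases "t \<ge> 0") (auto simp: \<psi>_def t_def[symmetric] field_simps)
  hence s: "s = r powr (- \<alpha>)"
    using r by (simp add: s_def \<psi>_def[symmetric] powr_minus inverse_powr)
  hence rs: "r powr \<alpha> * s = 1" using r by (simp add: powr_minus)
  have w: "v powr \<alpha> = of_real (r powr \<alpha>) * cis (\<alpha> * t)"
    by (rule complex_eqI) (use v r in \<open>simp_all add: powr_def Re_exp Im_exp r_def t_def\<close>)
  have n: "norm (v powr \<alpha>) = r powr \<alpha>" using r by (simp add: w norm_mult)
  have "(norm (v powr \<alpha> - 1))\<^sup>2 = (r powr \<alpha> * cos (\<alpha> * t) - 1)\<^sup>2 + (r powr \<alpha> * sin (\<alpha> * t))\<^sup>2"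
    by (simp add: w cmod_power2)
  also have "\<dots> = (r powr \<alpha>)\<^sup>2 * ((cos (\<alpha> * t))\<^sup>2 + (sin (\<alpha> * t))\<^sup>2) - 2 * r powr \<alpha> * cos (\<alpha> * t) + 1"
    by algebra
  also have "\<dots> = (r powr \<alpha>)\<^sup>2 - 2 * r powr \<alpha> * cos (\<alpha> * t) * (r powr \<alpha> * s) + (r powr \<alpha> * s)\<^sup>2"
    by (simp add: rs)
  also have "\<dots> = (r powr \<alpha>)\<^sup>2 * (1 - 2 * s * cos (\<alpha> * t) + s\<^sup>2)"
    by (simp add: power2_eq_square algebra_simps)
  also have "cos (\<alpha> * t) = cos (\<alpha> * \<psi>)"
    by (cases "t \<ge> 0") (auto simp: \<psi>_def t_def[symmetric])
  finally show "(norm (v powr \<alpha> - 1))\<^sup>2 = (norm (v powr \<alpha>))\<^sup>2 * (1 - 2 * s * cos (\<alpha> * \<psi>) + s\<^sup>2)"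
    by (simp add: n)
qed

text \<open>
  On the line through the saddle point with argument \<open>\<theta>\<close> the kernel is largest at that point, where
  the addition formula for \<open>sin ((1 + \<alpha>) * \<theta>)\<close> evaluates it.
\<close>

lemma kernel_on_line_saddle:
  fixes \<alpha> \<theta> \<sigma> :: real and v :: complex
  assumes "0 < \<alpha>" "\<alpha> \<le> 1" "0 < \<theta>" "\<theta> < pi / 2"
    and \<sigma>: "\<sigma> = cos \<theta> * (sin \<theta> / sin ((1 + \<alpha>) * \<theta>)) powr (1 / \<alpha>)" and "Re v = \<sigma>"
  shows "norm (v powr \<alpha>) \<le> sin \<theta> / sin (\<alpha> * \<theta>) * norm (v powr \<alpha> - 1)"
proof -
  define S where "S = sin ((1 + \<alpha>) * \<theta>)"
  have pos: "cos \<theta> > 0" "sin \<theta> > 0" "S > 0"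
    using assms sin_add_one_pos[of \<alpha> \<theta>] by (auto intro!: cos_gt_zero sin_gt_zero simp: S_def)
  have pos': "sin (\<alpha> * \<theta>) > 0"
    using scaled_angle[OF assms(1-4)] by (intro sin_gt_zero)
  have sp: "\<sigma> > 0" using pos by (simp add: \<sigma> S_def)
  have "\<sigma> powr \<alpha> = cos \<theta> powr \<alpha> * (sin \<theta> / S)"
    using pos assms(1) by (simp add: \<sigma> S_def[symmetric] powr_mult powr_powr)
  hence loc: "\<sigma> powr \<alpha> = saddle_locus \<alpha> \<theta>" by (simp add: saddle_locus_def S_def)
  define s where "s = (\<lambda>t. (cos t / \<sigma>) powr \<alpha>)"
  have s\<theta>: "s \<theta> = S / sin \<theta>"
    using pos sp by (simp add: s_def powr_divide \<open>\<sigma> powr \<alpha> = cos \<theta> powr \<alpha> * (sin \<theta> / S)\<close>)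
  have Sa: "S = sin \<theta> * cos (\<alpha> * \<theta>) + cos \<theta> * sin (\<alpha> * \<theta>)"
    by (simp add: S_def distrib_right sin_add)
  have q\<theta>: "1 - 2 * s \<theta> * cos (\<alpha> * \<theta>) + (s \<theta>)\<^sup>2 = (sin (\<alpha> * \<theta>) / sin \<theta>)\<^sup>2"
  proof -
    let ?a = "cos (\<alpha> * \<theta>)" and ?b = "sin (\<alpha> * \<theta>)" and ?c = "cos \<theta>" and ?d = "sin \<theta>"
    have "?d\<^sup>2 - 2 * S * ?d * ?a + S\<^sup>2 = ?d\<^sup>2 * (1 - ?a\<^sup>2) + ?c\<^sup>2 * ?b\<^sup>2"
      unfolding Sa by (simp add: power2_eq_square algebra_simps)
    also have "1 - ?a\<^sup>2 = ?b\<^sup>2" by (simp add: sin_squared_eq)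
    also have "?d\<^sup>2 * ?b\<^sup>2 + ?c\<^sup>2 * ?b\<^sup>2 = ?b\<^sup>2"
      by (simp add: distrib_right[symmetric])
    finally show ?thesis using pos by (simp add: s\<theta> field_simps power2_eq_square)
  qed
  define \<psi> where "\<psi> = \<bar>Im (Ln v)\<bar>"
  have polar: "(norm (v powr \<alpha> - 1))\<^sup>2 = (norm (v powr \<alpha>))\<^sup>2 * (1 - 2 * s \<psi> * cos (\<alpha> * \<psi>) + (s \<psi>)\<^sup>2)"
    "0 \<le> \<psi>" "\<psi> < pi / 2"
    using norm_powr_minus_one_polar(1)[of v \<alpha>] norm_powr_minus_one_polar(2,3)[of v] sp \<open>Re v = \<sigma>\<close> by (simp_all add: \<psi>_def s_def)
  have "(sin (\<alpha> * \<theta>) / sin \<theta>)\<^sup>2 \<le> 1 - 2 * s \<psi> * cos (\<alpha> * \<psi>) + (s \<psi>)\<^sup>2"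
    unfolding q\<theta>[symmetric] s_def
    by (rule line_kernel_min)
       (use assms polar sp loc saddle_locus_antimono[of \<alpha>] in auto)
  hence "(norm (v powr \<alpha>) * (sin (\<alpha> * \<theta>) / sin \<theta>))\<^sup>2 \<le> (norm (v powr \<alpha> - 1))\<^sup>2"
    unfolding polar(1) power_mult_distrib by (intro mult_left_mono) auto
  hence "norm (v powr \<alpha>) * (sin (\<alpha> * \<theta>) / sin \<theta>) \<le> norm (v powr \<alpha> - 1)"
    by (rule power2_le_imp_le) simp
  thus ?thesis using pos pos' by (simp add: field_simps)
qed

text \<open>
  The whole locus of the saddle points lies to the left of such a line, so the kernel is largest on
  the real axis.
\<close>

lemma kernel_on_line_right:
  fixes \<alpha> \<sigma> :: real and v :: complex
  assumes "0 < \<alpha>" "\<alpha> \<le> 1" "(1 + \<alpha>) powr (- 1 / \<alpha>) \<le> \<sigma>" "\<sigma> < 1" "Re v = \<sigma>"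
  shows "norm (v powr \<alpha>) \<le> 1 / (\<sigma> powr (- \<alpha>) - 1) * norm (v powr \<alpha> - 1)"
proof -
  have "0 < (1 + \<alpha>) powr (- 1 / \<alpha>)" using assms by simp
  hence sp: "\<sigma> > 0" using assms by linarith
  have "((1 + \<alpha>) powr (- 1 / \<alpha>)) powr \<alpha> \<le> \<sigma> powr \<alpha>" using assms by (intro powr_mono2) auto
  hence loc: "1 / (1 + \<alpha>) \<le> \<sigma> powr \<alpha>"
    unfolding powr_powr using assms by (simp add: powr_minus divide_inverse)
  define s where "s = (\<lambda>t. (cos t / \<sigma>) powr \<alpha>)"
  have s0: "s 0 = \<sigma> powr (- \<alpha>)" using sp by (simp add: s_def powr_minus_divide powr_divide)
  have "\<sigma> powr \<alpha> < 1 powr \<alpha>" using assms sp by (intro powr_less_mono2) auto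
  hence gt: "s 0 > 1" using sp by (simp add: s0 powr_minus one_less_inverse_iff)
  define \<psi> where "\<psi> = \<bar>Im (Ln v)\<bar>"
  have polar: "(norm (v powr \<alpha> - 1))\<^sup>2 = (norm (v powr \<alpha>))\<^sup>2 * (1 - 2 * s \<psi> * cos (\<alpha> * \<psi>) + (s \<psi>)\<^sup>2)"
    "0 \<le> \<psi>" "\<psi> < pi / 2"
    using norm_powr_minus_one_polar(1)[of v \<alpha>] norm_powr_minus_one_polar(2,3)[of v] sp \<open>Re v = \<sigma>\<close> by (simp_all add: \<psi>_def s_def)
  have "1 - 2 * s 0 * cos (\<alpha> * 0) + (s 0)\<^sup>2 \<le> 1 - 2 * s \<psi> * cos (\<alpha> * \<psi>) + (s \<psi>)\<^sup>2"
    unfolding s_def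
    by (rule line_kernel_min)
       (use assms polar sp loc saddle_locus_le[of \<alpha>] in \<open>auto intro: order_trans\<close>)
  hence "(s 0 - 1)\<^sup>2 \<le> 1 - 2 * s \<psi> * cos (\<alpha> * \<psi>) + (s \<psi>)\<^sup>2"
    by (simp add: power2_eq_square algebra_simps)
  hence "(norm (v powr \<alpha>) * (s 0 - 1))\<^sup>2 \<le> (norm (v powr \<alpha> - 1))\<^sup>2"
    unfolding polar(1) power_mult_distrib by (intro mult_left_mono) auto
  hence "norm (v powr \<alpha>) * (s 0 - 1) \<le> norm (v powr \<alpha> - 1)"
    by (rule power2_le_imp_le) simp
  thus ?thesis using gt by (simp add: field_simps s0)
qed

section \<open>The bound attached to a vertical line\<close>

text \<open>
  The argument \<open>\<alpha> * \<beta> + 1\<close> may approach \<open>0\<close>, where \<open>Gamma\<close> has a pole; the reciprocal is entire.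
\<close>

lemma inverse_Gamma_bounded:
  fixes B :: real
  obtains K where "K > 0" "\<And>y. 0 < y \<Longrightarrow> y \<le> B \<Longrightarrow> 1 / Gamma y \<le> K"
proof -
  have "compact ((rGamma :: real \<Rightarrow> real) ` {0..B})"
    by (intro compact_continuous_image continuous_on_rGamma compact_Icc)
  hence "bounded ((rGamma :: real \<Rightarrow> real) ` {0..B})" by (rule compact_imp_bounded)
  then obtain K where K: "K > 0" "\<And>y. y \<in> {0..B} \<Longrightarrow> \<bar>rGamma y\<bar> \<le> K"
    unfolding bounded_pos by auto
  show thesis
  proof (rule that[OF K(1)])
    fix y :: real assume "0 < y" "y \<le> B"
    thus "1 / Gamma y \<le> K"
      using K(2)[of y] by (simp add: rGamma_inverse_Gamma divide_inverse)
  qed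
qed

lemma parameter_bounds:
  fixes \<alpha> \<beta> :: real
  assumes "0 < \<alpha>" "\<alpha> \<le> 1" "1 - 1 / \<alpha> \<le> \<beta>"
  shows "0 \<le> beta_bar \<alpha> \<beta>" "beta_bar \<alpha> \<beta> \<le> 1 + \<bar>\<beta>\<bar>" "0 < \<alpha> * \<beta> + 1" "\<alpha> * \<beta> + 1 \<le> 1 + \<bar>\<beta>\<bar>"
proof -
  have 1: "\<alpha> * \<beta> \<le> \<bar>\<beta>\<bar>"
    using assms by (smt (verit) mult_left_le_one_le mult_nonneg_nonpos)
  have "\<alpha> * (1 - 1 / \<alpha>) \<le> \<alpha> * \<beta>" using assms by (intro mult_left_mono) auto
  hence 2: "\<alpha> - 1 \<le> \<alpha> * \<beta>" using assms by (simp add: algebra_simps)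
  show "0 \<le> beta_bar \<alpha> \<beta>" "beta_bar \<alpha> \<beta> \<le> 1 + \<bar>\<beta>\<bar>" "0 < \<alpha> * \<beta> + 1" "\<alpha> * \<beta> + 1 \<le> 1 + \<bar>\<beta>\<bar>"
    using 1 2 assms by (auto simp: beta_bar_eq)
qed

lemma norm_powr_diff_one_le:
  fixes p b r \<sigma> R :: real
  assumes "0 \<le> p" "p \<le> b" "0 < \<sigma>" "\<sigma> \<le> r" "r \<le> R" "1 \<le> R"
  shows "r powr (p - 1) \<le> R powr b / \<sigma>"
proof -
  have "r powr p \<le> R powr p" using assms by (intro powr_mono2) auto
  also have "\<dots> \<le> R powr b" using assms by (intro powr_mono) auto
  finally have "r powr p / r \<le> R powr b / \<sigma>" using assms by (intro frac_le) auto
  thus ?thesis using assms by (simp add: powr_diff)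
qed

lemma rectangle_norm_bounds:
  assumes "0 < \<sigma>" "\<sigma> \<le> Re v" "Re v \<le> R" "\<bar>Im v\<bar> \<le> R"
  shows "\<sigma> \<le> norm v" "norm v \<le> 2 * R"
  using assms abs_Re_le_cmod[of v] cmod_le[of v] by linarith+

lemma powr_ge_one_plus:
  assumes "3 \<le> (r::real)" "0 < \<alpha>"
  shows "1 + \<alpha> \<le> r powr \<alpha>"
proof -
  have "exp 1 \<le> r" using exp_le assms by linarith
  hence "1 \<le> ln r" using assms by (simp add: ln_ge_iff)
  hence "1 + \<alpha> \<le> 1 + \<alpha> * ln r" using assms by simp
  also have "\<dots> \<le> exp (\<alpha> * ln r)" by (rule exp_ge_add_one_self)
  finally show ?thesis using assms by (simp add: powr_def)
qed

text \<open>
  Since \<open>3 > exp 1\<close>, the modulus of \<open>v powr \<alpha>\<close> is at least \<open>1 + \<alpha>\<close> here.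
\<close>

lemma kernel_far:
  fixes \<alpha> :: real and v :: complex
  assumes "0 < \<alpha>" "\<alpha> \<le> 1" "3 \<le> norm v"
  shows "norm (v powr \<alpha>) \<le> 2 / \<alpha> * norm (v powr \<alpha> - 1)"
proof -
  define t where "t = norm (v powr \<alpha>)"
  have t: "1 + \<alpha> \<le> t"
    using powr_ge_one_plus[OF assms(3,1)] by (simp add: t_def norm_powr_real_powr')
  have "2 \<le> (1 + \<alpha>) * (2 - \<alpha>)" using assms by (simp add: algebra_simps mult_left_le)
  also have "\<dots> \<le> t * (2 - \<alpha>)" using t assms by (intro mult_right_mono) auto
  finally have "t * \<alpha> \<le> 2 * (t - 1)" by (simp add: algebra_simps)
  also have "t - 1 \<le> norm (v powr \<alpha> - 1)"
    using norm_triangle_ineq2[of "v powr \<alpha>" 1] by (simp add: t_def)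
  finally show ?thesis using assms by (simp add: t_def field_simps)
qed

text \<open>
  Far from the real axis \<open>v powr (- \<alpha>)\<close> varies slowly: moving from \<open>u\<close> to \<open>v\<close> changes it by at most
  \<open>\<alpha> * R powr (- \<alpha> - 1) * \<bar>u - v\<bar>\<close> with \<open>R = \<bar>Im v\<bar>\<close>, while \<open>\<bar>1 - v powr (- \<alpha>)\<bar>\<close> is at least
  \<open>\<alpha> * R powr (- \<alpha>)\<close>. The kernel thus grows by a factor \<open>1 + \<bar>u - v\<bar> / R\<close> at most, which does not
  degenerate as \<open>\<alpha>\<close> tends to \<open>0\<close>.
\<close>

lemma kernel_horizontal:
  fixes \<alpha> c :: real and v u :: complex
  assumes "0 < \<alpha>" "\<alpha> \<le> 1" "0 < Re u" "Re u \<le> Re v" "Im u = Im v" "3 \<le> \<bar>Im v\<bar>" "1 \<le> c * \<bar>Im v\<bar>"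
    and u: "norm (u powr \<alpha>) \<le> m * norm (u powr \<alpha> - 1)"
  shows "norm (v powr \<alpha>) \<le> m * exp (c * (Re v - Re u)) * norm (v powr \<alpha> - 1)"
proof -
  define R where "R = \<bar>Im v\<bar>"
  have R: "3 \<le> R" "1 \<le> c * R" using assms by (auto simp: R_def)
  define A where "A = (\<lambda>z::complex. z powr of_real (- \<alpha>))"
  define L where "L = {z. 0 < Re z} \<inter> {z. Im z = Im v}"
  have cvL: "convex L" unfolding L_def
    by (intro convex_Int convex_halfspace_Re_gt) (auto simp: convex_def simp flip: distrib_right)
  have Ra: "1 + \<alpha> \<le> R powr \<alpha>" using powr_ge_one_plus[OF R(1) assms(1)] .
  have c: "c > 0" using R by (smt (verit) mult_nonpos_nonneg)
  have diff: "norm (A u - A v) \<le> \<alpha> * R powr (- \<alpha> - 1) * norm (u - v)"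
  proof (rule field_differentiable_bound[OF cvL])
    fix z assume z: "z \<in> L"
    hence "z \<notin> \<real>\<^sub>\<le>\<^sub>0" by (auto simp: L_def elim!: nonpos_Reals_cases)
    thus "(A has_field_derivative of_real (- \<alpha>) * z powr (of_real (- \<alpha>) - 1)) (at z within L)"
      unfolding A_def by (rule has_field_derivative_at_within[OF has_field_derivative_powr])
    have zR: "R \<le> norm z" using z abs_Im_le_cmod[of z] by (simp add: L_def R_def)
    have "norm (z powr (of_real (- \<alpha>) - 1)) = norm z powr (- \<alpha> - 1)"
      using norm_powr_real_powr'[of "complex_of_real (- \<alpha> - 1)" z] by simp
    also have "\<dots> \<le> R powr (- \<alpha> - 1)" using zR R assms by (intro powr_mono2') auto
    finally show "norm (of_real (- \<alpha>) * z powr (of_real (- \<alpha>) - 1)) \<le> \<alpha> * R powr (- \<alpha> - 1)"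
      using assms by (simp add: norm_mult)
  qed (use assms in \<open>auto simp: L_def\<close>)
  have uv: "norm (u - v) = Re v - Re u" using assms by (simp add: cmod_def)
  have key: "norm (1 - A u) \<le> norm (1 - A v) * exp (c * (Re v - Re u))"
  proof -
    have "R \<le> norm v" using abs_Im_le_cmod[of v] by (simp add: R_def)
    hence "norm (A v) \<le> R powr (- \<alpha>)"
      using assms R by (auto simp: A_def norm_powr_real_powr' intro!: powr_mono2')
    hence low: "1 - R powr (- \<alpha>) \<le> norm (1 - A v)"
      using norm_triangle_ineq2[of 1 "A v"] by simp
    have "R powr (- \<alpha> - 1) = R powr (- \<alpha>) / R" using R by (simp add: powr_diff)
    hence "\<alpha> * R powr (- \<alpha> - 1) = \<alpha> * R powr (- \<alpha>) / R" by simp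
    also have "\<dots> \<le> (1 - R powr (- \<alpha>)) / R"
    proof (rule divide_right_mono)
      have "(1 + \<alpha>) * R powr (- \<alpha>) \<le> R powr \<alpha> * R powr (- \<alpha>)" using Ra by (rule mult_right_mono) simp
      also have "\<dots> = 1" using R by (simp add: powr_minus)
      finally show "\<alpha> * R powr (- \<alpha>) \<le> 1 - R powr (- \<alpha>)" by (simp add: algebra_simps)
    qed (use R in simp)
    also have "\<dots> \<le> norm (1 - A v) / R" using low R by (intro divide_right_mono) auto
    also have "\<dots> \<le> norm (1 - A v) * c"
    proof -
      have "1 / R \<le> c" using R by (simp add: field_simps)
      from mult_left_mono[OF this, of "norm (1 - A v)"] show ?thesis by simp
    qed
    finally have k: "\<alpha> * R powr (- \<alpha> - 1) \<le> norm (1 - A v) * c" .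
    have "norm (1 - A u) \<le> norm (1 - A v) + norm (A u - A v)"
      using norm_triangle_ineq[of "1 - A v" "A v - A u"] by (simp add: norm_minus_commute)
    also have "norm (A u - A v) \<le> norm (1 - A v) * c * (Re v - Re u)"
      using diff mult_right_mono[OF k, of "Re v - Re u"] assms unfolding uv by linarith
    also have "norm (1 - A v) + norm (1 - A v) * c * (Re v - Re u) = norm (1 - A v) * (1 + c * (Re v - Re u))"
      by (simp add: algebra_simps)
    also have "\<dots> \<le> norm (1 - A v) * exp (c * (Re v - Re u))"
      by (intro mult_left_mono exp_ge_add_one_self) auto
    finally show ?thesis by simp
  qed
  have conv: "norm (z powr \<alpha> - 1) = norm (z powr \<alpha>) * norm (1 - A z)" if "0 < Re z" for z
  proof -
    have "z \<noteq> 0" using that by auto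
    hence "z powr \<alpha> - 1 = z powr \<alpha> * (1 - A z)"
      by (simp add: A_def powr_minus right_diff_distrib)
    thus ?thesis by (metis norm_mult)
  qed
  have nz: "norm (z powr \<alpha>) > 0" if "0 < Re z" for z using that by auto
  have "1 \<le> m * norm (1 - A u)"
    using u nz[OF assms(3)] by (simp add: conv[OF assms(3)] mult.left_commute)
  moreover hence "m \<ge> 0" by (smt (verit) mult_nonpos_nonneg norm_ge_zero)
  ultimately have "1 \<le> m * (norm (1 - A v) * exp (c * (Re v - Re u)))"
    using mult_left_mono[OF key, of m] by linarith
  hence "norm (v powr \<alpha>) * 1 \<le> norm (v powr \<alpha>) * (m * (norm (1 - A v) * exp (c * (Re v - Re u))))"
    by (intro mult_left_mono) auto
  thus ?thesis using conv[of v] assms by (simp add: mult.commute mult.left_commute)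
qed

lemma divide_le_of_le_mult: "a \<le> m * b \<Longrightarrow> 0 \<le> m \<Longrightarrow> 0 \<le> b \<Longrightarrow> a / b \<le> (m::real)"
  by (cases "b = 0") (auto simp: field_simps)

text \<open>
  The rectangle has size \<open>R = 3 + 2 / c\<close>. On its horizontal sides the kernel is at most
  \<open>m * exp (c * (Re v - \<sigma>))\<close> by comparison with the corner on the line, and on the right side it is
  at most \<open>4 * m \<le> m * exp (c * (R - 1))\<close>; since \<open>X \<ge> c * n\<close>, the factor \<open>exp (- X * Re v)\<close>
  compensates the \<open>n\<close>-th power of this growth. The hypothesis \<open>1 / 2 \<le> \<alpha> * m\<close> makes \<open>4 * m\<close> a bound
  of the kernel away from the line, uniformly in \<open>\<alpha>\<close>.
\<close>

lemma abs_W_le_line: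
  fixes \<beta> c :: real
  assumes "0 < c"
  obtains K where "K > 0"
    "\<And>\<alpha> \<sigma> m x n. \<lbrakk>0 < \<alpha>; \<alpha> \<le> 1; 1 - 1 / \<alpha> \<le> \<beta>; 0 < \<sigma>; \<sigma> < 1; 1 / 2 \<le> \<alpha> * m; 0 < x;
        c * real n \<le> x powr (1 / \<alpha>);
        \<And>v. Re v = \<sigma> \<Longrightarrow> norm (v powr complex_of_real \<alpha>) \<le> m * norm (v powr complex_of_real \<alpha> - 1)\<rbrakk>
      \<Longrightarrow> \<bar>W \<alpha> \<beta> n x\<bar> \<le> K * (m / \<sigma>) * (x powr beta_sub \<alpha> \<beta> * (m ^ n * exp (- \<sigma> * x powr (1 / \<alpha>))))"
proof -
  define R where "R = 3 + 2 / c"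
  have R: "3 \<le> R" "1 \<le> c * R" "2 \<le> c * (R - 1)" using assms by (simp_all add: R_def field_simps)
  obtain G where G: "G > 0" "\<And>y. 0 < y \<Longrightarrow> y \<le> 1 + \<bar>\<beta>\<bar> \<Longrightarrow> 1 / Gamma y \<le> G"
    using inverse_Gamma_bounded[of "1 + \<bar>\<beta>\<bar>"] by blast
  define K where "K = (2 * R) powr (1 + \<bar>\<beta>\<bar>) * 4 * (3 * R) * G"
  have K: "K > 0" using R G by (simp add: K_def)
  show thesis
  proof (rule that[OF K])
    fix \<alpha> \<sigma> m x :: real and n :: nat
    assume a: "0 < \<alpha>" "\<alpha> \<le> 1" "1 - 1 / \<alpha> \<le> \<beta>" "0 < \<sigma>" "\<sigma> < 1" "1 / 2 \<le> \<alpha> * m" "0 < x"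
        "c * real n \<le> x powr (1 / \<alpha>)"
      and line: "\<And>v. Re v = \<sigma> \<Longrightarrow> norm (v powr complex_of_real \<alpha>) \<le> m * norm (v powr complex_of_real \<alpha> - 1)"
    note p = parameter_bounds[OF a(1-3)]
    define X where "X = x powr (1 / \<alpha>)"
    have m: "m > 0" using a(1,6) zero_less_mult_pos[of \<alpha> m] by linarith
    have m4: "2 / \<alpha> \<le> 4 * m" using a(1,6) by (simp add: field_simps)
    define q where "q = (\<lambda>v. norm (v powr complex_of_real \<alpha>) / norm (v powr complex_of_real \<alpha> - 1))"
    define M where "M = (2 * R) powr (1 + \<bar>\<beta>\<bar>) / \<sigma> * (4 * m * (m ^ n * exp (- \<sigma> * X)))"
    have M0: "0 \<le> M" using m a by (simp add: M_def)
    have far: "q v \<le> 4 * m" if "3 \<le> norm v" for v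
    proof -
      have "q v \<le> 2 / \<alpha>" unfolding q_def
        using kernel_far[OF a(1,2) that] a(1) by (intro divide_le_of_le_mult) auto
      thus ?thesis using m4 by linarith
    qed
    have "\<bar>W \<alpha> \<beta> n x\<bar> \<le> x powr beta_sub \<alpha> \<beta> * M * (R + 2 * R) / Gamma (\<alpha> * \<beta> + 1)"
    proof (rule abs_W_le_rectangle[OF a(1-3,7,4,5) _ _ M0])
      fix v assume v: "\<sigma> \<le> Re v" "Re v \<le> R" "\<bar>Im v\<bar> \<le> R" "Re v = \<sigma> \<or> Re v = R \<or> \<bar>Im v\<bar> = R"
      define d where "d = Re v - \<sigma>"
      have d: "d \<ge> 0" using v by (simp add: d_def)
      have q: "q v \<le> 4 * m \<and> q v \<le> m * exp (c * d)"
      proof -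
        consider "Re v = \<sigma>" | "Re v = R" | "\<bar>Im v\<bar> = R" using v by blast
        thus ?thesis
        proof cases
          case 1
          hence "q v \<le> m" unfolding q_def
            using line[OF 1] m by (intro divide_le_of_le_mult) auto
          thus ?thesis using m 1 by (simp add: d_def)
        next
          case 2
          have "3 \<le> norm v" using 2 R abs_Re_le_cmod[of v] by simp
          note f = far[OF this]
          have "c * (R - 1) \<le> c * d" using 2 a assms by (simp add: d_def)
          hence e: "exp 2 \<le> exp (c * d)" using R by simp
          have "(4::real) \<le> exp 2"
          proof -
            have "2 * 2 \<le> exp 1 * (exp 1 :: real)"
              using exp_ge_add_one_self[of "1::real"] by (intro mult_mono) auto
            thus ?thesis by (simp flip: exp_add)
          qed
          from order_trans[OF this e] have "4 * m \<le> exp (c * d) * m"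
            by (rule mult_right_mono) (use m in simp)
          thus ?thesis using f by (simp add: mult.commute)
        next
          case 3
          have "3 \<le> norm v" using 3 R abs_Im_le_cmod[of v] by simp
          note f = far[OF this]
          have "norm (v powr \<alpha>) \<le> m * exp (c * (Re v - Re (Complex \<sigma> (Im v)))) * norm (v powr \<alpha> - 1)"
            by (rule kernel_horizontal[OF a(1,2)]) (use a v 3 R line in auto)
          hence "q v \<le> m * exp (c * d)" unfolding q_def d_def
            using m by (intro divide_le_of_le_mult) auto
          thus ?thesis using f by blast
        qed
      qed
      have q0: "q v \<ge> 0" by (simp add: q_def)
      have "q v ^ n \<le> (m * exp (c * d)) ^ n" using q q0 by (intro power_mono) auto
      also have "\<dots> = m ^ n * exp (c * real n * d)"
        by (simp add: power_mult_distrib exp_of_nat_mult[symmetric] mult_ac)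
      also have "\<dots> \<le> m ^ n * exp (X * d)"
        using m a(8) d by (intro mult_left_mono) (auto simp: X_def intro: mult_right_mono)
      finally have "q v * q v ^ n \<le> 4 * m * (m ^ n * exp (X * d))"
        using q q0 m by (intro mult_mono) auto
      hence "q v ^ Suc n * exp (- X * Re v) \<le> 4 * m * (m ^ n * exp (X * d)) * exp (- X * Re v)"
        by (intro mult_right_mono) auto
      also have "\<dots> = 4 * m * (m ^ n * exp (- \<sigma> * X))"
        by (simp add: d_def mult.assoc algebra_simps flip: exp_add)
      finally have 1: "q v ^ Suc n * exp (- X * Re v) \<le> 4 * m * (m ^ n * exp (- \<sigma> * X))" .
      have 2: "norm v powr (beta_bar \<alpha> \<beta> - 1) \<le> (2 * R) powr (1 + \<bar>\<beta>\<bar>) / \<sigma>"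
        using rectangle_norm_bounds[OF a(4) v(1-3)] p a R by (intro norm_powr_diff_one_le) auto
      have "norm v powr (beta_bar \<alpha> \<beta> - 1) * (q v ^ Suc n * exp (- X * Re v)) \<le> M"
        unfolding M_def by (rule mult_mono[OF 2 1]) (use q0 a in auto)
      thus "norm v powr (beta_bar \<alpha> \<beta> - 1) * (norm (v powr \<alpha>) / norm (v powr \<alpha> - 1)) ^ Suc n
          * exp (- (x powr (1 / \<alpha>)) * Re v) \<le> M"
        by (simp only: q_def X_def mult.assoc)
    qed (use R in auto)
    also have "\<dots> = x powr beta_sub \<alpha> \<beta> * M * (3 * R) * (1 / Gamma (\<alpha> * \<beta> + 1))" by simp
    also have "\<dots> \<le> x powr beta_sub \<alpha> \<beta> * M * (3 * R) * G"
      using G(2)[OF p(3,4)] M0 R by (intro mult_left_mono) auto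
    also have "\<dots> = K * (m / \<sigma>) * (x powr beta_sub \<alpha> \<beta> * (m ^ n * exp (- \<sigma> * x powr (1 / \<alpha>))))"
      by (simp add: K_def M_def X_def)
    finally show "\<bar>W \<alpha> \<beta> n x\<bar> \<le> K * (m / \<sigma>) * (x powr beta_sub \<alpha> \<beta> * (m ^ n * exp (- \<sigma> * x powr (1 / \<alpha>))))" .
  qed
qed

section \<open>The function \<open>kappa_bar\<close>\<close>

text \<open>
  The logarithmic derivative is \<open>(1 + \<alpha>)\<^sup>2 * cot ((1 + \<alpha>) * t) - cot t - \<alpha>\<^sup>2 * cot (\<alpha> * t)\<close>. With
  \<open>P = cot t\<close>, \<open>Q = cot (\<alpha> * t)\<close> and \<open>cot ((1 + \<alpha>) * t) = (P * Q - 1) / (P + Q)\<close>, it is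
  \<open>- ((P - \<alpha> * Q)\<^sup>2 + (1 + \<alpha>)\<^sup>2) / (P + Q)\<close>.
\<close>

lemma kappa_bar_strict_antimono:
  assumes "0 < \<alpha>" "\<alpha> \<le> 1"
  shows "strict_antimono_on {0<..<pi / 2} (kappa_bar \<alpha>)"
proof (rule monotone_onI)
  fix \<theta> \<psi> :: real
  assume ends: "\<theta> \<in> {0<..<pi / 2}" "\<psi> \<in> {0<..<pi / 2}" and "\<theta> < \<psi>"
  let ?l = "\<lambda>t. \<alpha> * ln \<alpha> + (1 + \<alpha>) * ln (sin ((1 + \<alpha>) * t)) - ln (sin t) - \<alpha> * ln (sin (\<alpha> * t))"
  have pos: "sin t > 0" "sin ((1 + \<alpha>) * t) > 0" "sin (\<alpha> * t) > 0" if "0 < t" "t < pi / 2" for t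
  proof -
    show "sin t > 0" "sin ((1 + \<alpha>) * t) > 0"
      using that assms sin_add_one_pos[of \<alpha> t] by (auto intro!: sin_gt_zero)
    show "sin (\<alpha> * t) > 0" using scaled_angle[OF assms that] by (intro sin_gt_zero)
  qed
  have eq: "kappa_bar \<alpha> t = exp (?l t)" if "0 < t" "t < pi / 2" for t
  proof -
    note p = pos[OF that]
    have "?l t = \<alpha> * ln \<alpha> + (ln (sin ((1 + \<alpha>) * t)) - ln (sin t))
        + \<alpha> * (ln (sin ((1 + \<alpha>) * t)) - ln (sin (\<alpha> * t)))"
      by (simp add: algebra_simps)
    hence "exp (?l t) = exp (\<alpha> * ln \<alpha>) * exp (ln (sin ((1 + \<alpha>) * t)) - ln (sin t))
        * exp (\<alpha> * (ln (sin ((1 + \<alpha>) * t)) - ln (sin (\<alpha> * t))))"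
      by (simp only: exp_add)
    thus ?thesis using p assms
      by (simp add: kappa_bar_def exp_diff[of "ln _" "ln _"] powr_def ln_div)
  qed
  have "?l \<theta> > ?l \<psi>"
  proof (rule DERIV_neg_imp_decreasing[OF \<open>\<theta> < \<psi>\<close>])
    fix t assume t: "\<theta> \<le> t" "t \<le> \<psi>"
    hence t': "0 < t" "t < pi / 2" using ends by auto
    note p = pos[OF t']
    let ?P = "cos t / sin t" and ?Q = "cos (\<alpha> * t) / sin (\<alpha> * t)"
    let ?C = "cos ((1 + \<alpha>) * t) / sin ((1 + \<alpha>) * t)"
    have "(?l has_real_derivative ((1 + \<alpha>) * ((1 + \<alpha>) * ?C) - ?P - \<alpha> * (\<alpha> * ?Q))) (at t)"
      using p by (auto intro!: derivative_eq_intros simp: field_simps)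
    moreover have "(1 + \<alpha>) * ((1 + \<alpha>) * ?C) - ?P - \<alpha> * (\<alpha> * ?Q) < 0"
    proof -
      have S: "sin ((1 + \<alpha>) * t) = sin t * sin (\<alpha> * t) * (?P + ?Q)"
        using p by (simp add: distrib_right sin_add field_simps)
      have Co: "cos ((1 + \<alpha>) * t) = sin t * sin (\<alpha> * t) * (?P * ?Q - 1)"
        using p by (simp add: distrib_right cos_add field_simps)
      have "0 < sin t * sin (\<alpha> * t) * (?P + ?Q)" using p(2) by (simp only: S)
      hence PQ: "?P + ?Q > 0" by (rule zero_less_mult_pos) (use p in simp)
      have C: "?C = (?P * ?Q - 1) / (?P + ?Q)"
        unfolding S Co using p by simp
      have gen: "(1 + \<alpha>) * ((1 + \<alpha>) * ((P * Q - 1) / (P + Q))) - P - \<alpha> * (\<alpha> * Q) < 0"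
        if "P + Q > 0" for P Q :: real
      proof -
        have "0 < (P - \<alpha> * Q)\<^sup>2 + (1 + \<alpha>)\<^sup>2" using assms by (simp add: add_nonneg_pos)
        hence "(1 + \<alpha>) * ((1 + \<alpha>) * (P * Q - 1)) < (P + \<alpha> * (\<alpha> * Q)) * (P + Q)"
          by (simp add: power2_eq_square algebra_simps)
        hence "(1 + \<alpha>) * ((1 + \<alpha>) * (P * Q - 1)) / (P + Q) < P + \<alpha> * (\<alpha> * Q)"
          using that by (simp add: pos_divide_less_eq)
        thus ?thesis by simp
      qed
      show ?thesis unfolding C by (rule gen[OF PQ])
    qed
    ultimately show "\<exists>y. (?l has_real_derivative y) (at t) \<and> y < 0" by blast
  qed
  thus "kappa_bar \<alpha> \<theta> > kappa_bar \<alpha> \<psi>" using eq[of \<theta>] eq[of \<psi>] ends by simp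
qed

lemma kappa_bar_at_0:
  assumes "0 < \<alpha>"
  shows "(kappa_bar \<alpha> \<longlongrightarrow> A_bar \<alpha>) (at_right 0)"
proof -
  have 1: "((\<lambda>t::real. sin ((1 + \<alpha>) * t) / sin t) \<longlongrightarrow> 1 + \<alpha>) (at_right 0)"
    using assms by real_asymp
  have 2: "((\<lambda>t::real. sin ((1 + \<alpha>) * t) / sin (\<alpha> * t)) \<longlongrightarrow> (1 + \<alpha>) / \<alpha>) (at_right 0)"
    unfolding divide_inverse[of "1 + \<alpha>"] using assms by real_asymp
  have "((\<lambda>t. \<alpha> powr \<alpha> * (sin ((1 + \<alpha>) * t) / sin t) * (sin ((1 + \<alpha>) * t) / sin (\<alpha> * t)) powr \<alpha>)
      \<longlongrightarrow> \<alpha> powr \<alpha> * (1 + \<alpha>) * ((1 + \<alpha>) / \<alpha>) powr \<alpha>) (at_right 0)"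
    using assms by (intro tendsto_intros 1 2) auto
  also have "\<alpha> powr \<alpha> * (1 + \<alpha>) * ((1 + \<alpha>) / \<alpha>) powr \<alpha> = A_bar \<alpha>"
    using assms by (simp add: A_bar_def powr_divide powr_add)
  finally show ?thesis by (simp add: kappa_bar_def[abs_def])
qed

lemma kappa_bar_at_B: "kappa_bar \<alpha> (pi / (2 * (1 + \<alpha>))) = B_bar \<alpha>" if "0 < \<alpha>" "\<alpha> \<le> 1"
proof -
  have "(1 + \<alpha>) * (pi / (2 * (1 + \<alpha>))) = pi / 2"
    using that nonzero_mult_divide_mult_cancel_left[of "1 + \<alpha>" pi 2]
    by (simp only: times_divide_eq_right mult.commute[of 2])
  moreover have "\<alpha> * (pi / (2 * (1 + \<alpha>))) = pi * \<alpha> / (2 * (1 + \<alpha>))" by simp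
  moreover have "sin (pi * \<alpha> / (2 * (1 + \<alpha>))) \<ge> 0"
    using that by (intro sin_ge_zero) (auto simp: field_simps)
  ultimately show ?thesis by (simp only: kappa_bar_def B_bar_def csc_def) (simp add: powr_divide)
qed

lemma kappa_bar_at_half_pi: "kappa_bar \<alpha> (pi / 2) = C_bar \<alpha>" if "0 < \<alpha>" "\<alpha> \<le> 1"
proof -
  have S: "sin ((1 + \<alpha>) * (pi / 2)) = cos (pi / 2 * \<alpha>)"
    by (simp add: distrib_right sin_add mult.commute[of \<alpha>] del: times_divide_eq_right times_divide_eq_left)
  have "0 \<le> pi / 2 * \<alpha>" "pi / 2 * \<alpha> \<le> pi / 2" using that by (auto intro: mult_left_le)
  hence "cos (pi / 2 * \<alpha>) \<ge> 0" "sin (pi / 2 * \<alpha>) \<ge> 0"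
    using pi_gt_zero by (intro cos_ge_zero sin_ge_zero; linarith)+
  moreover have e: "\<alpha> * (pi / 2) = pi / 2 * \<alpha>" by simp
  moreover have "cos (pi / 2 * \<alpha>) powr (\<alpha> + 1) = cos (pi / 2 * \<alpha>) * cos (pi / 2 * \<alpha>) powr \<alpha>"
    using powr_mult_base[of "cos (pi / 2 * \<alpha>)" \<alpha>] calculation(1) by (simp only: add.commute)
  ultimately show ?thesis
    unfolding kappa_bar_def C_bar_def S e by (simp add: powr_divide)
qed

lemma kappa_bar_at_left:
  assumes "0 < \<alpha>" "\<alpha> \<le> 1"
  shows "(kappa_bar \<alpha> \<longlongrightarrow> C_bar \<alpha>) (at_left (pi / 2))"
proof -
  have s: "sin (\<alpha> * (pi / 2)) > 0" using assms pi_gt_zero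
    by (intro sin_gt_zero) (auto simp: field_simps intro: le_less_trans[of _ pi])
  have ev: "\<forall>\<^sub>F t in at_left (pi / 2). 0 \<le> sin ((1 + \<alpha>) * t) / sin (\<alpha> * t)"
    using eventually_at_left_real[OF pi_half_gt_zero]
  proof eventually_elim
    case (elim t)
    have "sin (\<alpha> * t) > 0" using scaled_angle[OF assms, of t] elim by (intro sin_gt_zero) auto
    thus ?case using sin_add_one_pos[of \<alpha> t] assms elim by simp
  qed
  have "(kappa_bar \<alpha> \<longlongrightarrow> kappa_bar \<alpha> (pi / 2)) (at_left (pi / 2))"
    unfolding kappa_bar_def
    by (intro tendsto_mult tendsto_powr' tendsto_divide tendsto_sin tendsto_const tendsto_ident_at)
       (use s ev assms in auto)
  thus ?thesis using kappa_bar_at_half_pi[OF assms] by simp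
qed

lemma C_bar_le_B_bar_le_A_bar:
  assumes "0 < \<alpha>" "\<alpha> \<le> 1"
  shows "C_bar \<alpha> \<le> B_bar \<alpha>" "B_bar \<alpha> \<le> A_bar \<alpha>"
proof -
  define t where "t = pi / (2 * (1 + \<alpha>))"
  have t: "0 < t" "t < pi / 2" using assms by (auto simp: t_def field_simps)
  note B = kappa_bar_at_B[OF assms, folded t_def]
  have mono: "kappa_bar \<alpha> u \<le> kappa_bar \<alpha> v" if "0 < v" "v < u" "u < pi / 2" for u v
    using monotone_onD[OF kappa_bar_strict_antimono[OF assms], of v u] that by auto
  show "C_bar \<alpha> \<le> B_bar \<alpha>" unfolding B[symmetric]
  proof (rule tendsto_upperbound[OF kappa_bar_at_left[OF assms]])
    show "\<forall>\<^sub>F u in at_left (pi / 2). kappa_bar \<alpha> u \<le> kappa_bar \<alpha> t"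
      using eventually_at_left_real[OF t(2)] by eventually_elim (use mono t in auto)
  qed (simp add: trivial_limit_at_left_real)
  show "B_bar \<alpha> \<le> A_bar \<alpha>" unfolding B[symmetric]
  proof (rule tendsto_lowerbound[OF kappa_bar_at_0[OF assms(1)]])
    show "\<forall>\<^sub>F u in at_right 0. kappa_bar \<alpha> t \<le> kappa_bar \<alpha> u"
      using eventually_at_right_real[OF t(1)] by eventually_elim (use mono t in auto)
  qed simp
qed


section \<open>The merging point of the saddle points and the exponent \<open>H\<close>\<close>

text \<open>
  Convexity of \<open>exp\<close>, used in place of Bernoulli's inequality for real exponents.
\<close>

lemma exp_mult_le:
  fixes t y :: real
  assumes "0 \<le> t" "t \<le> 1"
  shows "exp (t * y) \<le> 1 - t + t * exp y"
proof -
  have "convex_on UNIV (exp :: real \<Rightarrow> real)"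
    by (rule f''_ge0_imp_convex[where f' = exp and f'' = exp]) (auto intro!: derivative_eq_intros)
  from convex_onD[OF this assms, of 0 y] show ?thesis by simp
qed

text \<open>
  For \<open>x = A_bar \<alpha> * n powr \<alpha>\<close> the two conjugate saddle points coincide here. It is also the left end
  point of \<open>E_int \<alpha>\<close>, and its \<open>\<alpha>\<close>-th power is the limit of \<open>saddle_locus \<alpha>\<close> at \<open>0\<close>.
\<close>

definition merge_point :: "real \<Rightarrow> real" where
  "merge_point \<alpha> = (1 + \<alpha>) powr (- 1 / \<alpha>)"

lemma merge_point_powr:
  assumes "0 < \<alpha>"
  shows "merge_point \<alpha> powr \<alpha> = 1 / (1 + \<alpha>)" "merge_point \<alpha> powr (- \<alpha>) = 1 + \<alpha>"
    "merge_point \<alpha> * (1 + \<alpha>) powr ((1 + \<alpha>) / \<alpha>) = 1 + \<alpha>"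
proof -
  have e: "- 1 / \<alpha> * \<alpha> = - 1" "- 1 / \<alpha> * - \<alpha> = 1" "- 1 / \<alpha> + (1 + \<alpha>) / \<alpha> = 1"
    using assms by (auto simp: field_simps)
  show "merge_point \<alpha> powr \<alpha> = 1 / (1 + \<alpha>)" "merge_point \<alpha> powr (- \<alpha>) = 1 + \<alpha>"
    unfolding merge_point_def powr_powr e using assms by (simp_all add: powr_minus divide_inverse)
  show "merge_point \<alpha> * (1 + \<alpha>) powr ((1 + \<alpha>) / \<alpha>) = 1 + \<alpha>"
    unfolding merge_point_def powr_add[symmetric] e using assms by simp
qed

lemma merge_point_bounds:
  assumes "0 < \<alpha>" "\<alpha> \<le> 1"
  shows "1 / 3 \<le> merge_point \<alpha>" "merge_point \<alpha> \<le> 1 / 2"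
proof -
  define r where "r = (1 + \<alpha>) powr (1 / \<alpha>)"
  have mr: "merge_point \<alpha> = 1 / r"
    by (simp add: merge_point_def r_def powr_minus_divide)
  have "(1 + \<alpha>) powr (1 / \<alpha>) \<le> exp \<alpha> powr (1 / \<alpha>)"
    using assms by (intro powr_mono2) auto
  hence "r \<le> 3" using exp_le assms by (simp add: r_def powr_def[of "exp \<alpha>"])
  have "exp (\<alpha> * ln 2) \<le> 1 + \<alpha>" using exp_mult_le[of \<alpha> "ln 2"] assms by simp
  hence "2 powr \<alpha> \<le> 1 + \<alpha>" by (simp add: powr_def)
  hence "(2 powr \<alpha>) powr (1 / \<alpha>) \<le> r" unfolding r_def using assms by (intro powr_mono2) auto
  hence "2 \<le> r" using assms by (simp add: powr_powr)
  show "1 / 3 \<le> merge_point \<alpha>" "merge_point \<alpha> \<le> 1 / 2"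
    using \<open>r \<le> 3\<close> \<open>2 \<le> r\<close> unfolding mr by (auto simp: field_simps)
qed

lemma E_int_merge_point: "\<eta> \<in> E_int \<alpha> \<longleftrightarrow> merge_point \<alpha> \<le> \<eta> \<and> \<eta> < 1"
  by (simp add: E_int_def merge_point_def add.commute)

text \<open>
  The function \<open>t * (1 - t powr \<alpha>)\<close> is largest at \<open>merge_point \<alpha>\<close>; after scaling \<open>t\<close> by it, the claim
  is \<open>(1 + \<alpha>) * w \<le> \<alpha> + w powr (1 + \<alpha>)\<close>.
\<close>

lemma tangent_at_merge_point:
  fixes \<alpha> t :: real
  assumes "0 < \<alpha>" "0 < t"
  shows "(1 + \<alpha>) powr ((1 + \<alpha>) / \<alpha>) * (t * (1 - t powr \<alpha>)) \<le> \<alpha>"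
proof -
  define w where "w = t / merge_point \<alpha>"
  have mp: "merge_point \<alpha> > 0" using assms by (simp add: merge_point_def)
  have w: "w > 0" "t = merge_point \<alpha> * w" using mp assms by (simp_all add: w_def)
  have "exp (1 / (1 + \<alpha>) * ((1 + \<alpha>) * ln w)) \<le> 1 - 1 / (1 + \<alpha>) + 1 / (1 + \<alpha>) * exp ((1 + \<alpha>) * ln w)"
    using assms by (intro exp_mult_le) auto
  hence "w \<le> 1 - 1 / (1 + \<alpha>) + 1 / (1 + \<alpha>) * w powr (1 + \<alpha>)"
    using assms w by (simp add: powr_def)
  hence "(1 + \<alpha>) * w \<le> (1 + \<alpha>) * (1 - 1 / (1 + \<alpha>) + 1 / (1 + \<alpha>) * w powr (1 + \<alpha>))"
    using assms by (intro mult_left_mono) auto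
  also have "\<dots> = \<alpha> + w powr (1 + \<alpha>)"
    using assms by (simp only: distrib_left right_diff_distrib) simp
  finally have "(1 + \<alpha>) * w \<le> \<alpha> + w powr (1 + \<alpha>)" .
  hence "(1 + \<alpha>) * w - w * w powr \<alpha> \<le> \<alpha>" using w by (simp add: powr_add)
  moreover have "(1 + \<alpha>) powr ((1 + \<alpha>) / \<alpha>) * (t * (1 - t powr \<alpha>)) =
      (merge_point \<alpha> * (1 + \<alpha>) powr ((1 + \<alpha>) / \<alpha>)) * w * (1 - merge_point \<alpha> powr \<alpha> * w powr \<alpha>)"
    using w mp by (simp add: powr_mult)
  moreover have "\<dots> = (1 + \<alpha>) * w - w * w powr \<alpha>"
    unfolding merge_point_powr[OF assms(1)] using assms by (simp add: field_simps)
  ultimately show ?thesis by simp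
qed

text \<open>
  The factor \<open>(1 + \<alpha>) powr ((1 + \<alpha>) / \<alpha>)\<close> is the smallest slope of \<open>- ln (t powr (- \<alpha>) - 1)\<close>, attained at
  \<open>merge_point \<alpha>\<close>, so the difference to a line of this slope is nondecreasing.
\<close>

lemma log_kernel_minus_tangent_mono:
  fixes \<alpha> s t :: real
  assumes "0 < \<alpha>" "0 < s" "s \<le> t" "t < 1"
  shows "- ln (s powr (- \<alpha>) - 1) - (1 + \<alpha>) powr ((1 + \<alpha>) / \<alpha>) * s
    \<le> - ln (t powr (- \<alpha>) - 1) - (1 + \<alpha>) powr ((1 + \<alpha>) / \<alpha>) * t"
proof (rule DERIV_nonneg_imp_nondecreasing[OF assms(3),
      where f = "\<lambda>t. - ln (t powr (- \<alpha>) - 1) - (1 + \<alpha>) powr ((1 + \<alpha>) / \<alpha>) * t"])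
  fix u assume u: "s \<le> u" "u \<le> t"
  hence u': "0 < u" "u < 1" using assms by auto
  let ?x = "(1 + \<alpha>) powr ((1 + \<alpha>) / \<alpha>)"
  have lt: "u powr \<alpha> < 1" using u' assms powr_less_mono2[of \<alpha> u 1] by simp
  have up: "u powr \<alpha> > 0" using u' by simp
  have inv: "u powr (- \<alpha>) = 1 / u powr \<alpha>" by (simp add: powr_minus_divide)
  have gt: "u powr (- \<alpha>) - 1 > 0" using lt up by (simp add: inv)
  have der: "((\<lambda>t. - ln (t powr (- \<alpha>) - 1) - ?x * t) has_real_derivative
      - ((- \<alpha> * u powr (- \<alpha> - 1)) / (u powr (- \<alpha>) - 1)) - ?x) (at u)"
    using gt u' by (auto intro!: derivative_eq_intros)
  have eq: "- ((- \<alpha> * u powr (- \<alpha> - 1)) / (u powr (- \<alpha>) - 1)) = \<alpha> / (u * (1 - u powr \<alpha>))"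
    using u' up lt by (simp add: powr_diff inv field_simps)
  have "0 < u * (1 - u powr \<alpha>)" using u' lt by simp
  hence "?x \<le> \<alpha> / (u * (1 - u powr \<alpha>))"
    using tangent_at_merge_point[OF assms(1) u'(1)] by (simp only: pos_le_divide_eq)
  hence "0 \<le> \<alpha> / (u * (1 - u powr \<alpha>)) - ?x" by (simp only: diff_ge_0_iff_ge)
  with der show "\<exists>y. ((\<lambda>t. - ln (t powr (- \<alpha>) - 1) - ?x * t) has_real_derivative y) (at u) \<and> 0 \<le> y"
    unfolding eq by blast
qed

text \<open>
  The two functions agree at \<open>merge_point \<alpha>\<close> and their difference is monotone.
\<close>

lemma H_eq_max:
  assumes "0 < \<alpha>" "\<alpha> \<le> 1" "0 < \<eta>" "\<eta> < 1"
  shows "H \<alpha> \<eta> = max (\<eta> * (1 + \<alpha>) powr ((\<alpha> + 1) / \<alpha>) - (\<alpha> + 1) - ln \<alpha>) (- ln (\<eta> powr (- \<alpha>) - 1))"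
proof -
  note mb = merge_point_bounds[OF assms(1,2)] and mp = merge_point_powr[OF assms(1)]
  let ?x = "(1 + \<alpha>) powr ((1 + \<alpha>) / \<alpha>)"
  have at_mp: "- ln (merge_point \<alpha> powr (- \<alpha>) - 1) - ?x * merge_point \<alpha> = - ln \<alpha> - (1 + \<alpha>)"
    unfolding mp using mp(3) by (simp add: mult.commute)
  show ?thesis
  proof (cases "merge_point \<alpha> \<le> \<eta>")
    case True
    have "- ln \<alpha> - (1 + \<alpha>) \<le> - ln (\<eta> powr (- \<alpha>) - 1) - ?x * \<eta>"
      unfolding at_mp[symmetric]
      by (rule log_kernel_minus_tangent_mono) (use assms mb True in auto)
    thus ?thesis using True assms
      by (simp add: H_def E_int_merge_point max_def add.commute mult.commute)
  next
    case False
    have "- ln (\<eta> powr (- \<alpha>) - 1) - ?x * \<eta> \<le> - ln \<alpha> - (1 + \<alpha>)"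
      unfolding at_mp[symmetric]
      by (rule log_kernel_minus_tangent_mono) (use assms mb False in auto)
    thus ?thesis using False assms
      by (simp add: H_def E_int_merge_point max_def add.commute mult.commute)
  qed
qed

lemma half_open_subset_E_int: "{1 / 2..<1} \<subseteq> E_int \<alpha>" if "0 < \<alpha>" "\<alpha> \<le> 1"
  using merge_point_bounds[OF that] by (auto simp: E_int_merge_point)

lemma tendsto_H_half:
  assumes "0 < \<alpha>" "\<alpha> < 1"
  shows "(H \<alpha> \<longlongrightarrow> H \<alpha> (1 / 2)) (at (1 / 2))"
proof -
  let ?f = "\<lambda>\<eta>. max (\<eta> * (1 + \<alpha>) powr ((\<alpha> + 1) / \<alpha>) - (\<alpha> + 1) - ln \<alpha>) (- ln (\<eta> powr (- \<alpha>) - 1))"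
  have "(1 / 2) powr (- \<alpha>) = 2 powr \<alpha>" by (simp add: powr_minus_divide powr_divide)
  moreover have "2 powr \<alpha> > 1" using assms powr_less_mono2[of \<alpha> 1 2] by simp
  ultimately have "(?f \<longlongrightarrow> ?f (1 / 2)) (at (1 / 2))"
    by (intro tendsto_max tendsto_intros) auto
  moreover have "\<forall>\<^sub>F \<eta> in at (1 / 2). ?f \<eta> = H \<alpha> \<eta>"
  proof -
    have "\<forall>\<^sub>F \<eta>::real in at (1 / 2). \<eta> \<in> {0<..<1}"
      by (rule eventually_at_in_open') auto
    thus ?thesis by eventually_elim (use H_eq_max[of \<alpha>] assms in auto)
  qed
  ultimately have "(H \<alpha> \<longlongrightarrow> ?f (1 / 2)) (at (1 / 2))" using tendsto_cong by fast
  thus ?thesis using H_eq_max[of \<alpha> "1 / 2"] assms by simp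
qed

lemma tendsto_H_half_at_left: "((\<lambda>\<alpha>. H \<alpha> (1 / 2)) \<longlongrightarrow> 0) (at_left 1)"
proof -
  have "((\<lambda>\<alpha>::real. - ln (2 powr \<alpha> - 1)) \<longlongrightarrow> - ln (2 powr 1 - 1)) (at_left 1)"
    by (intro tendsto_intros) auto
  moreover have "\<forall>\<^sub>F \<alpha> in at_left 1. - ln (2 powr \<alpha> - 1) = H \<alpha> (1 / 2)"
    using eventually_at_left_real[of 0 "1::real", simplified]
  proof eventually_elim
    case (elim \<alpha>)
    hence "1 / 2 \<in> E_int \<alpha>" using half_open_subset_E_int[of \<alpha>] by auto
    thus ?case
      by (simp add: H_def powr_minus_divide powr_divide)
  qed
  ultimately show ?thesis using tendsto_cong by force
qed

section \<open>The oscillatory and the monotone range\<close>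

lemma power_eq_exp_ln:
  fixes m :: real
  assumes "0 < m"
  shows "m ^ n = exp (real n * ln m)"
  using assms by (simp add: exp_of_nat_mult)

lemma merge_point_line:
  fixes \<alpha> :: real
  assumes "0 < \<alpha>" "\<alpha> \<le> 1" "Re v = merge_point \<alpha>"
  shows "norm (v powr \<alpha>) \<le> 1 / \<alpha> * norm (v powr \<alpha> - 1)"
  using kernel_on_line_right[of \<alpha> "merge_point \<alpha>" v] merge_point_powr(2)[OF assms(1)]
    merge_point_bounds[OF assms(1,2)] assms
  by (simp add: merge_point_def)

lemma powr_root_scale:
  fixes a x \<alpha> :: real
  assumes "0 < \<alpha>" "0 \<le> a" "0 < n"
  shows "(a * real n powr \<alpha>) powr (1 / \<alpha>) = a powr (1 / \<alpha>) * real n"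
  using assms by (simp add: powr_mult powr_powr)

lemma A_bar_powr: "0 < \<alpha> \<Longrightarrow> A_bar \<alpha> powr (1 / \<alpha>) = (1 + \<alpha>) powr ((1 + \<alpha>) / \<alpha>)"
  by (simp add: A_bar_def powr_powr add.commute)

text \<open>
  The line \<open>\<sigma> = merge_point \<alpha>\<close> gives the exponent \<open>- n * ln \<alpha> - merge_point \<alpha> * X\<close>. With
  \<open>\<xi> = (1 + \<alpha>) powr ((1 + \<alpha>) / \<alpha>)\<close> one has \<open>merge_point \<alpha> * \<xi> = 1 + \<alpha>\<close>, so the exponent in the
  claim exceeds it by \<open>(1 / 2 - merge_point \<alpha>) * (n * \<xi> - X) \<ge> 0\<close>.
\<close>

lemma abs_W_le_oscillatory:
  fixes \<beta> c :: real
  assumes "0 < c"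
  obtains K where "K > 0"
    "\<And>\<alpha> x n. \<lbrakk>0 < \<alpha>; \<alpha> \<le> 1; 1 - 1 / \<alpha> \<le> \<beta>; 1 \<le> n; 0 < x; c * real n \<le> x powr (1 / \<alpha>);
        x < A_bar \<alpha> * real n powr \<alpha>\<rbrakk>
      \<Longrightarrow> \<bar>W \<alpha> \<beta> n x\<bar> \<le> K / \<alpha> * (x powr beta_sub \<alpha> \<beta> * exp (- (1 / 2) * x powr (1 / \<alpha>))
            * exp (real n * (- ln \<alpha> + 1 / 2 * (1 + \<alpha>) powr ((1 + \<alpha>) / \<alpha>) - 1 - \<alpha>)))"
proof -
  obtain K where K: "K > 0" and bound:
    "\<And>\<alpha> \<sigma> m x n. \<lbrakk>0 < \<alpha>; \<alpha> \<le> 1; 1 - 1 / \<alpha> \<le> \<beta>; 0 < \<sigma>; \<sigma> < 1; 1 / 2 \<le> \<alpha> * m; 0 < x;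
        c * real n \<le> x powr (1 / \<alpha>);
        \<And>v. Re v = \<sigma> \<Longrightarrow> norm (v powr complex_of_real \<alpha>) \<le> m * norm (v powr complex_of_real \<alpha> - 1)\<rbrakk>
      \<Longrightarrow> \<bar>W \<alpha> \<beta> n x\<bar> \<le> K * (m / \<sigma>) * (x powr beta_sub \<alpha> \<beta> * (m ^ n * exp (- \<sigma> * x powr (1 / \<alpha>))))"
    using abs_W_le_line[OF assms, of \<beta>] by metis
  show thesis
  proof (rule that[of "3 * K"])
    show "3 * K > 0" using K by simp
    fix \<alpha> x :: real and n :: nat
    assume a: "0 < \<alpha>" "\<alpha> \<le> 1" "1 - 1 / \<alpha> \<le> \<beta>" "1 \<le> n" "0 < x" "c * real n \<le> x powr (1 / \<alpha>)"
      "x < A_bar \<alpha> * real n powr \<alpha>"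
    define X where "X = x powr (1 / \<alpha>)"
    define \<xi> where "\<xi> = (1 + \<alpha>) powr ((1 + \<alpha>) / \<alpha>)"
    let ?v = "merge_point \<alpha>"
    note mb = merge_point_bounds[OF a(1,2)]
    have X\<xi>: "X \<le> \<xi> * real n"
    proof -
      have "X \<le> (A_bar \<alpha> * real n powr \<alpha>) powr (1 / \<alpha>)"
        unfolding X_def using a by (intro powr_mono2) auto
      also have "\<dots> = A_bar \<alpha> powr (1 / \<alpha>) * real n"
        using a by (intro powr_root_scale) (auto simp: A_bar_def)
      finally show ?thesis by (simp add: A_bar_powr[OF a(1)] \<xi>_def)
    qed
    have "(1 / 2 - ?v) * X \<le> (1 / 2 - ?v) * (\<xi> * real n)" using X\<xi> mb by (intro mult_left_mono) auto
    hence "- ?v * X \<le> - (1 / 2) * X + real n * (1 / 2 * \<xi> - ?v * \<xi>)" by (simp add: algebra_simps)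
    also have "?v * \<xi> = 1 + \<alpha>" using merge_point_powr(3)[OF a(1)] by (simp add: \<xi>_def)
    finally have e: "- ?v * X \<le> - (1 / 2) * X + real n * (1 / 2 * \<xi> - (1 + \<alpha>))" .
    have "\<bar>W \<alpha> \<beta> n x\<bar> \<le> K * (1 / \<alpha> / ?v) * (x powr beta_sub \<alpha> \<beta> * ((1 / \<alpha>) ^ n * exp (- ?v * X)))"
      unfolding X_def by (rule bound) (use a mb merge_point_line[OF a(1,2)] in auto)
    also have "\<dots> \<le> K * (3 / \<alpha>) * (x powr beta_sub \<alpha> \<beta> *
        (exp (real n * - ln \<alpha>) * exp (- (1 / 2) * X + real n * (1 / 2 * \<xi> - (1 + \<alpha>)))))"
    proof (intro mult_mono)
      have "1 / ?v \<le> 3" using mb by (simp add: field_simps)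
      from divide_right_mono[OF this, of \<alpha>] show "1 / \<alpha> / ?v \<le> 3 / \<alpha>" using a by (simp add: mult.commute)
      show "(1 / \<alpha>) ^ n \<le> exp (real n * - ln \<alpha>)"
        using a power_eq_exp_ln[of "1 / \<alpha>" n] by (simp add: ln_div)
      show "exp (- ?v * X) \<le> exp (- (1 / 2) * X + real n * (1 / 2 * \<xi> - (1 + \<alpha>)))" using e by simp
    qed (use K a mb in auto)
    also have "\<dots> = 3 * K / \<alpha> * (x powr beta_sub \<alpha> \<beta> * (exp (- (1 / 2) * X)
        * exp (real n * (- ln \<alpha> + 1 / 2 * \<xi> - 1 - \<alpha>))))"
      by (simp add: algebra_simps flip: exp_add)
    finally show "\<bar>W \<alpha> \<beta> n x\<bar> \<le> 3 * K / \<alpha> * (x powr beta_sub \<alpha> \<beta> * exp (- (1 / 2) * x powr (1 / \<alpha>))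
            * exp (real n * (- ln \<alpha> + 1 / 2 * (1 + \<alpha>) powr ((1 + \<alpha>) / \<alpha>) - 1 - \<alpha>)))"
      by (simp only: X_def \<xi>_def mult.assoc)
  qed
qed

text \<open>
  As \<open>C_bar \<alpha> \<ge> 0\<close>, already \<open>x > \<epsilon> * n powr \<alpha>\<close> bounds \<open>X / n\<close> away from \<open>0\<close> uniformly in \<open>\<alpha> \<ge> \<alpha>0\<close>.
\<close>

lemma abs_W_le_above_C_bar:
  fixes \<alpha>0 \<epsilon> \<beta> :: real
  assumes "0 < \<alpha>0" "0 < \<epsilon>"
  shows "\<exists>(n0::nat) (K::real). \<forall>n\<ge>n0. \<forall>(\<alpha>::real) (x::real).
           \<alpha>0 \<le> \<alpha> \<and> \<alpha> \<le> 1 \<and> 1 - 1 / \<alpha> \<le> \<beta> \<and> \<epsilon> < B_bar \<alpha> - C_bar \<alpha> \<and>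
           (C_bar \<alpha> + \<epsilon>) * real n powr \<alpha> < x \<and> x < A_bar \<alpha> * real n powr \<alpha> \<longrightarrow>
           \<bar>W \<alpha> \<beta> n x\<bar> \<le>
             K * (x powr beta_sub \<alpha> \<beta> * exp (- (1 / 2) * x powr (1 / \<alpha>))
                  * exp (real n * (- ln \<alpha> + 1 / 2 * (1 + \<alpha>) powr ((1 + \<alpha>) / \<alpha>) - 1 - \<alpha>)))"
proof -
  define c where "c = min 1 \<epsilon> powr (1 / \<alpha>0)"
  have c: "c > 0" using assms by (simp add: c_def)
  obtain K where K: "K > 0" and bound: "\<And>\<alpha> x n. \<lbrakk>0 < \<alpha>; \<alpha> \<le> 1; 1 - 1 / \<alpha> \<le> \<beta>; 1 \<le> n; 0 < x; c * real n \<le> x powr (1 / \<alpha>);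
        x < A_bar \<alpha> * real n powr \<alpha>\<rbrakk>
      \<Longrightarrow> \<bar>W \<alpha> \<beta> n x\<bar> \<le> K / \<alpha> * (x powr beta_sub \<alpha> \<beta> * exp (- (1 / 2) * x powr (1 / \<alpha>))
            * exp (real n * (- ln \<alpha> + 1 / 2 * (1 + \<alpha>) powr ((1 + \<alpha>) / \<alpha>) - 1 - \<alpha>)))"
    using abs_W_le_oscillatory[OF c, of \<beta>] by metis
  show ?thesis
  proof (intro exI[of _ "1::nat"] exI[of _ "K / \<alpha>0"] allI impI, elim conjE)
    fix n :: nat and \<alpha> x :: real
    assume n: "1 \<le> n" and a: "\<alpha>0 \<le> \<alpha>" "\<alpha> \<le> 1" "1 - 1 / \<alpha> \<le> \<beta>"
      and x: "(C_bar \<alpha> + \<epsilon>) * real n powr \<alpha> < x" "x < A_bar \<alpha> * real n powr \<alpha>"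
    have a0: "0 < \<alpha>" using a assms by linarith
    have "C_bar \<alpha> \<ge> 0" by (simp add: C_bar_def)
    hence "\<epsilon> * real n powr \<alpha> \<le> (C_bar \<alpha> + \<epsilon>) * real n powr \<alpha>" by (intro mult_right_mono) auto
    hence x1: "\<epsilon> * real n powr \<alpha> \<le> x" using x by linarith
    have "0 < \<epsilon> * real n powr \<alpha>" using assms n by simp
    hence x0: "0 < x" using x1 by linarith
    have "min 1 \<epsilon> powr (1 / \<alpha>0) \<le> min 1 \<epsilon> powr (1 / \<alpha>)"
      using assms a a0 by (intro powr_mono') (auto simp: frac_le)
    also have "\<dots> \<le> \<epsilon> powr (1 / \<alpha>)" using assms a0 by (intro powr_mono2) auto
    finally have "c * real n \<le> \<epsilon> powr (1 / \<alpha>) * real n" by (simp add: c_def mult_right_mono)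
    also have "\<dots> = (\<epsilon> * real n powr \<alpha>) powr (1 / \<alpha>)"
      by (rule powr_root_scale[symmetric]) (use a0 assms n in auto)
    also have "\<dots> \<le> x powr (1 / \<alpha>)" using x1 assms a0 by (intro powr_mono2) auto
    finally have "\<bar>W \<alpha> \<beta> n x\<bar> \<le> K / \<alpha> * (x powr beta_sub \<alpha> \<beta> * exp (- (1 / 2) * x powr (1 / \<alpha>))
            * exp (real n * (- ln \<alpha> + 1 / 2 * (1 + \<alpha>) powr ((1 + \<alpha>) / \<alpha>) - 1 - \<alpha>)))"
      using bound[OF a0 a(2,3) n x0 _ x(2)] by blast
    also have "\<dots> \<le> K / \<alpha>0 * (x powr beta_sub \<alpha> \<beta> * exp (- (1 / 2) * x powr (1 / \<alpha>))
            * exp (real n * (- ln \<alpha> + 1 / 2 * (1 + \<alpha>) powr ((1 + \<alpha>) / \<alpha>) - 1 - \<alpha>)))"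
      using K assms a by (intro mult_right_mono frac_le) auto
    finally show "\<bar>W \<alpha> \<beta> n x\<bar> \<le> K / \<alpha>0 * (x powr beta_sub \<alpha> \<beta> * exp (- (1 / 2) * x powr (1 / \<alpha>))
            * exp (real n * (- ln \<alpha> + 1 / 2 * (1 + \<alpha>) powr ((1 + \<alpha>) / \<alpha>) - 1 - \<alpha>)))" .
  qed
qed

text \<open>
  This keeps \<open>X / n\<close> above \<open>1 / 2\<close> for \<open>x > B_bar \<alpha> * n powr \<alpha>\<close>, uniformly down to \<open>\<alpha> = 0\<close>.
\<close>

lemma half_powr_le_B_bar:
  assumes "0 < \<alpha>" "\<alpha> \<le> 1"
  shows "(1 / 2) powr \<alpha> \<le> B_bar \<alpha>"
proof -
  define t where "t = pi / (2 * (1 + \<alpha>))"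
  define u where "u = pi * \<alpha> / (2 * (1 + \<alpha>))"
  have t0: "0 < t" using assms by (simp add: t_def)
  have "t < pi / 1" unfolding t_def using assms by (intro divide_strict_left_mono) auto
  with t0 have t: "0 < t" "t < pi" by auto
  have u: "0 < u" using assms by (simp add: u_def)
  have "u \<le> pi * \<alpha> / 2" using assms unfolding u_def by (intro divide_left_mono) auto
  also have "\<dots> \<le> 4 * \<alpha> / 2" using assms pi_less_4 by (intro divide_right_mono mult_right_mono) auto
  finally have u2: "u \<le> 2 * \<alpha>" by simp
  have "pi * \<alpha> / 2 \<le> pi / 2" using assms by simp
  hence "u < pi" using \<open>u \<le> pi * \<alpha> / 2\<close> pi_gt_zero by linarith
  hence su: "0 < sin u" using u by (intro sin_gt_zero) auto
  have "sin u \<le> 2 * \<alpha>" using sin_x_le_x[of u] u u2 by linarith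
  hence "1 / 2 \<le> \<alpha> / sin u" using su by (simp add: field_simps)
  hence "(1 / 2) powr \<alpha> \<le> (\<alpha> / sin u) powr \<alpha>" using assms by (intro powr_mono2) auto
  also have "\<dots> = \<alpha> powr \<alpha> * (1 / sin u powr \<alpha>)" using su assms by (simp add: powr_divide)
  also have "\<dots> \<le> \<alpha> powr \<alpha> * (1 / sin t / sin u powr \<alpha>)"
  proof (intro mult_left_mono divide_right_mono)
    show "1 \<le> 1 / sin t" using sin_gt_zero[OF t] by (simp add: field_simps)
  qed auto
  finally show ?thesis by (simp add: B_bar_def csc_def t_def u_def)
qed

lemma abs_W_le_above_B_bar:
  fixes \<beta> :: real
  shows "\<exists>(n0::nat) (K::real). \<forall>n\<ge>n0. \<forall>(\<alpha>::real) (x::real).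
        0 < \<alpha> \<and> \<alpha> \<le> 1 \<and> 1 - 1 / \<alpha> \<le> \<beta> \<and>
        B_bar \<alpha> * real n powr \<alpha> < x \<and> x < A_bar \<alpha> * real n powr \<alpha> \<longrightarrow>
        \<bar>W \<alpha> \<beta> n x\<bar> \<le>
          K / \<alpha> * (x powr beta_sub \<alpha> \<beta> * exp (- (1 / 2) * x powr (1 / \<alpha>))
               * exp (real n * (- ln \<alpha> + 1 / 2 * (1 + \<alpha>) powr ((1 + \<alpha>) / \<alpha>) - 1 - \<alpha>)))"
proof -
  obtain K where K: "K > 0" and bound: "\<And>\<alpha> x n. \<lbrakk>0 < \<alpha>; \<alpha> \<le> 1; 1 - 1 / \<alpha> \<le> \<beta>; 1 \<le> n; 0 < x; 1 / 2 * real n \<le> x powr (1 / \<alpha>);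
        x < A_bar \<alpha> * real n powr \<alpha>\<rbrakk>
      \<Longrightarrow> \<bar>W \<alpha> \<beta> n x\<bar> \<le> K / \<alpha> * (x powr beta_sub \<alpha> \<beta> * exp (- (1 / 2) * x powr (1 / \<alpha>))
            * exp (real n * (- ln \<alpha> + 1 / 2 * (1 + \<alpha>) powr ((1 + \<alpha>) / \<alpha>) - 1 - \<alpha>)))"
    using abs_W_le_oscillatory[of "1 / 2" \<beta>] by (metis half_gt_zero_iff zero_less_one)
  show ?thesis
  proof (intro exI[of _ "1::nat"] exI[of _ K] allI impI, elim conjE)
    fix n :: nat and \<alpha> x :: real
    assume n: "1 \<le> n" and a: "0 < \<alpha>" "\<alpha> \<le> 1" "1 - 1 / \<alpha> \<le> \<beta>"
      and x: "B_bar \<alpha> * real n powr \<alpha> < x" "x < A_bar \<alpha> * real n powr \<alpha>"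
    have "(1 / 2) powr \<alpha> * real n powr \<alpha> \<le> B_bar \<alpha> * real n powr \<alpha>"
      using half_powr_le_B_bar[OF a(1,2)] by (intro mult_right_mono) auto
    hence x1: "(1 / 2) powr \<alpha> * real n powr \<alpha> \<le> x" using x by linarith
    have "0 < (1 / 2) powr \<alpha> * real n powr \<alpha>" using n by simp
    hence x0: "0 < x" using x1 by linarith
    have "1 / 2 * real n = ((1 / 2) powr \<alpha> * real n powr \<alpha>) powr (1 / \<alpha>)"
      using a n by (subst powr_root_scale) (auto simp: powr_powr)
    also have "\<dots> \<le> x powr (1 / \<alpha>)" using x1 a by (intro powr_mono2) auto
    finally show "\<bar>W \<alpha> \<beta> n x\<bar> \<le> K / \<alpha> * (x powr beta_sub \<alpha> \<beta> * exp (- (1 / 2) * x powr (1 / \<alpha>))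
            * exp (real n * (- ln \<alpha> + 1 / 2 * (1 + \<alpha>) powr ((1 + \<alpha>) / \<alpha>) - 1 - \<alpha>)))"
      using bound[OF a n x0 _ x(2)] by blast
  qed
qed

text \<open>
  For \<open>\<eta> \<in> E_int \<alpha>\<close> the line \<open>\<sigma> = \<eta>\<close> gives the claim directly, with a kernel of size
  at most \<open>1 / (\<alpha> * ln (1 / \<eta>))\<close>. Otherwise the line \<open>\<sigma> = merge_point \<alpha>\<close> is used, whose exponent
  is smaller than the claimed one by \<open>(merge_point \<alpha> - \<eta>) * (X - n * \<xi>) \<ge> 0\<close>, with
  \<open>\<xi> = (1 + \<alpha>) powr ((1 + \<alpha>) / \<alpha>)\<close>.
\<close>

lemma abs_W_le_above_A_bar:
  fixes \<beta> \<eta> :: real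
  assumes "\<eta> < 1"
  shows "\<exists>(n0::nat) (K::real). \<forall>n\<ge>n0. \<forall>(\<alpha>::real) (x::real).
        0 < \<alpha> \<and> \<alpha> < 1 \<and> 1 - 1 / \<alpha> \<le> \<beta> \<and> 0 < x \<and> A_bar \<alpha> * real n powr \<alpha> \<le> x \<longrightarrow>
        \<bar>W \<alpha> \<beta> n x\<bar> \<le>
          K * (\<alpha> powr (- 5 / 2) * x powr beta_sub \<alpha> \<beta> * exp (- \<eta> * x powr (1 / \<alpha>))
               * exp (real n * H \<alpha> \<eta>))"
proof -
  obtain K where K: "K > 0" and bound:
    "\<And>\<alpha> \<sigma> m x n. \<lbrakk>0 < \<alpha>; \<alpha> \<le> 1; 1 - 1 / \<alpha> \<le> \<beta>; 0 < \<sigma>; \<sigma> < 1; 1 / 2 \<le> \<alpha> * m; 0 < x;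
        1 * real n \<le> x powr (1 / \<alpha>);
        \<And>v. Re v = \<sigma> \<Longrightarrow> norm (v powr complex_of_real \<alpha>) \<le> m * norm (v powr complex_of_real \<alpha> - 1)\<rbrakk>
      \<Longrightarrow> \<bar>W \<alpha> \<beta> n x\<bar> \<le> K * (m / \<sigma>) * (x powr beta_sub \<alpha> \<beta> * (m ^ n * exp (- \<sigma> * x powr (1 / \<alpha>))))"
    using abs_W_le_line[of 1 \<beta>] zero_less_one by metis
  define L where "L = ln (1 / max \<eta> (1 / 3))"
  have L: "L > 0" unfolding L_def using assms by (subst ln_gt_zero_iff) (auto simp: max_def)
  show ?thesis
  proof (intro exI[of _ "1::nat"] exI[of _ "K * (3 * (1 + 1 / L))"] allI impI, elim conjE)
    fix n :: nat and \<alpha> x :: real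
    assume n: "1 \<le> n" and a: "0 < \<alpha>" "\<alpha> < 1" "1 - 1 / \<alpha> \<le> \<beta>" "0 < x" and x: "A_bar \<alpha> * real n powr \<alpha> \<le> x"
    define X where "X = x powr (1 / \<alpha>)"
    define \<xi> where "\<xi> = (1 + \<alpha>) powr ((1 + \<alpha>) / \<alpha>)"
    let ?v = "merge_point \<alpha>"
    have a1: "\<alpha> \<le> 1" using a by simp
    note mb = merge_point_bounds[OF a(1) a1] and mp = merge_point_powr[OF a(1)]
    have X\<xi>: "\<xi> * real n \<le> X"
    proof -
      have "\<xi> * real n = A_bar \<alpha> powr (1 / \<alpha>) * real n" by (simp add: A_bar_powr[OF a(1)] \<xi>_def)
      also have "\<dots> = (A_bar \<alpha> * real n powr \<alpha>) powr (1 / \<alpha>)"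
        using a n by (intro powr_root_scale[symmetric]) (auto simp: A_bar_def)
      also have "\<dots> \<le> X" unfolding X_def using a x by (intro powr_mono2) (auto simp: A_bar_def)
      finally show ?thesis .
    qed
    have "1 \<le> \<xi>" unfolding \<xi>_def using a by (intro ge_one_powr_ge_zero) auto
    hence "1 * real n \<le> \<xi> * real n" by (intro mult_right_mono) auto
    hence Xn: "1 * real n \<le> x powr (1 / \<alpha>)" using X\<xi> by (simp add: X_def)
    have *: "\<bar>W \<alpha> \<beta> n x\<bar> \<le> K * (3 * (1 + 1 / L)) * (\<alpha> powr (- 5 / 2) * x powr beta_sub \<alpha> \<beta> * exp (- \<eta> * X)
               * exp (real n * H \<alpha> \<eta>))"
      if s: "1 / 3 \<le> \<sigma>" "\<sigma> < 1" "1 / \<alpha> \<le> m" "m \<le> 1 / \<alpha> * (1 + 1 / L)"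
        and line: "\<And>v. Re v = \<sigma> \<Longrightarrow> norm (v powr complex_of_real \<alpha>) \<le> m * norm (v powr complex_of_real \<alpha> - 1)"
        and e: "m ^ n * exp (- \<sigma> * X) \<le> exp (- \<eta> * X) * exp (real n * H \<alpha> \<eta>)"
      for \<sigma> m
    proof -
      have "\<alpha> * (1 / \<alpha>) \<le> \<alpha> * m" using s a by (intro mult_left_mono) auto
      hence "1 / 2 \<le> \<alpha> * m" using a by simp
      hence "\<bar>W \<alpha> \<beta> n x\<bar> \<le> K * (m / \<sigma>) * (x powr beta_sub \<alpha> \<beta> * (m ^ n * exp (- \<sigma> * X)))"
        unfolding X_def using bound[of \<alpha> \<sigma> m x n] a a1 s Xn line by auto
      have m0: "0 \<le> m" using s(3) a by (smt (verit) divide_nonneg_pos)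
      hence "m / \<sigma> \<le> m / (1 / 3)" using s by (intro divide_left_mono) auto
      also have "\<dots> = 3 * m" by simp
      also have "\<dots> \<le> 3 * (1 / \<alpha> * (1 + 1 / L))" using s(4) by (rule mult_left_mono) simp
      also have "\<dots> = 3 * (1 + 1 / L) * (1 / \<alpha>)" by (simp only: mult_ac)
      also have "1 / \<alpha> = \<alpha> powr (- 1)" using a by (simp add: powr_minus_divide)
      also have "3 * (1 + 1 / L) * \<alpha> powr (- 1) \<le> 3 * (1 + 1 / L) * \<alpha> powr (- 5 / 2)"
        using a L by (intro mult_left_mono powr_mono') auto
      finally have md: "m / \<sigma> \<le> 3 * (1 + 1 / L) * \<alpha> powr (- 5 / 2)" .
      note \<open>\<bar>W \<alpha> \<beta> n x\<bar> \<le> K * (m / \<sigma>) * (x powr beta_sub \<alpha> \<beta> * (m ^ n * exp (- \<sigma> * X)))\<close>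
      also have "K * (m / \<sigma>) * (x powr beta_sub \<alpha> \<beta> * (m ^ n * exp (- \<sigma> * X))) \<le>
          K * (3 * (1 + 1 / L) * \<alpha> powr (- 5 / 2)) *
          (x powr beta_sub \<alpha> \<beta> * (exp (- \<eta> * X) * exp (real n * H \<alpha> \<eta>)))"
        by (rule mult_mono[OF mult_left_mono[OF md] mult_left_mono[OF e]]) (use K L m0 in auto)
      also have "\<dots> = K * (3 * (1 + 1 / L)) * (\<alpha> powr (- 5 / 2) * x powr beta_sub \<alpha> \<beta> * exp (- \<eta> * X)
               * exp (real n * H \<alpha> \<eta>))" by simp
      finally show ?thesis .
    qed
    have "\<bar>W \<alpha> \<beta> n x\<bar> \<le> K * (3 * (1 + 1 / L)) * (\<alpha> powr (- 5 / 2) * x powr beta_sub \<alpha> \<beta> * exp (- \<eta> * X)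
               * exp (real n * H \<alpha> \<eta>))"
    proof (cases "\<eta> \<in> E_int \<alpha>")
      case True
      hence \<eta>: "?v \<le> \<eta>" "\<eta> < 1" "0 < \<eta>" using mb by (auto simp: E_int_merge_point)
      define m where "m = 1 / (\<eta> powr (- \<alpha>) - 1)"
      have L': "L = - ln \<eta>" using \<eta> mb by (simp add: L_def max_def ln_div)
      have "1 + \<alpha> * L \<le> exp (\<alpha> * L)" by (rule exp_ge_add_one_self)
      also have "\<dots> = \<eta> powr (- \<alpha>)" using \<eta> by (simp add: powr_def L')
      finally have low: "\<alpha> * L \<le> \<eta> powr (- \<alpha>) - 1" by simp
      have aL: "0 < \<alpha> * L" using a L by simp
      have "\<eta> powr (- \<alpha>) \<le> ?v powr (- \<alpha>)" using \<eta> mb a by (intro powr_mono2') auto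
      hence up: "\<eta> powr (- \<alpha>) - 1 \<le> \<alpha>" by (simp add: mp)
      show ?thesis
      proof (rule *[of \<eta> m])
        show "1 / 3 \<le> \<eta>" using mb \<eta> by linarith
        show "1 / \<alpha> \<le> m" unfolding m_def using up low aL by (intro divide_left_mono) auto
        have "m \<le> 1 / (\<alpha> * L)" unfolding m_def using low aL by (intro divide_left_mono) auto
        also have "\<dots> \<le> 1 / \<alpha> * (1 + 1 / L)" using a by (simp add: distrib_left)
        finally show "m \<le> 1 / \<alpha> * (1 + 1 / L)" .
        show "norm (v powr \<alpha>) \<le> m * norm (v powr \<alpha> - 1)" if "Re v = \<eta>" for v
          unfolding m_def by (rule kernel_on_line_right) (use a \<eta> that in \<open>auto simp: merge_point_def\<close>)
        have "m > 0" unfolding m_def using low aL by simp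
        hence "m ^ n = exp (real n * H \<alpha> \<eta>)"
          using True low aL by (simp add: power_eq_exp_ln H_def m_def ln_div)
        thus "m ^ n * exp (- \<eta> * X) \<le> exp (- \<eta> * X) * exp (real n * H \<alpha> \<eta>)" by simp
      qed (use \<eta> in auto)
    next
      case False
      hence \<eta>: "\<eta> < ?v" using assms by (auto simp: E_int_merge_point)
      have "(?v - \<eta>) * (\<xi> * real n) \<le> (?v - \<eta>) * X" using X\<xi> \<eta> by (intro mult_left_mono) auto
      hence "- ?v * X \<le> - \<eta> * X + real n * (\<eta> * \<xi> - ?v * \<xi>)" by (simp add: algebra_simps)
      also have "?v * \<xi> = 1 + \<alpha>" using mp(3) by (simp add: \<xi>_def)
      finally have e: "- ?v * X \<le> - \<eta> * X + real n * (\<eta> * \<xi> - (1 + \<alpha>))" .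
      show ?thesis
      proof (rule *[of ?v "1 / \<alpha>"])
        show "1 / \<alpha> \<le> 1 / \<alpha> * (1 + 1 / L)" using a L by (simp add: field_simps)
        show "norm (v powr \<alpha>) \<le> 1 / \<alpha> * norm (v powr \<alpha> - 1)" if "Re v = ?v" for v
          by (rule merge_point_line) (use a that in auto)
        have "(1 / \<alpha>) ^ n * exp (- ?v * X) \<le> exp (real n * - ln \<alpha>) * exp (- \<eta> * X + real n * (\<eta> * \<xi> - (1 + \<alpha>)))"
          using e a power_eq_exp_ln[of "1 / \<alpha>" n] by (simp add: ln_div)
        also have "\<dots> = exp (- \<eta> * X) * exp (real n * H \<alpha> \<eta>)"
          using False by (simp add: H_def \<xi>_def algebra_simps flip: exp_add)
        finally show "(1 / \<alpha>) ^ n * exp (- ?v * X) \<le> exp (- \<eta> * X) * exp (real n * H \<alpha> \<eta>)" .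
      qed (use mb in auto)
    qed
    thus "\<bar>W \<alpha> \<beta> n x\<bar> \<le> K * (3 * (1 + 1 / L)) * (\<alpha> powr (- 5 / 2) * x powr beta_sub \<alpha> \<beta> * exp (- \<eta> * x powr (1 / \<alpha>))
               * exp (real n * H \<alpha> \<eta>))" by (simp only: X_def)
  qed
qed

section \<open>The line through the saddle points, and fixed \<open>x\<close>\<close>

lemma half_le_sin:
  fixes t :: real
  assumes "0 \<le> t" "t \<le> pi / 2"
  shows "t / 2 \<le> sin t"
proof -
  have c: "0 \<le> cos t" using assms by (intro cos_ge_zero) auto
  have "t / 2 * cos (t / 2) \<le> sin (t / 2)" by (rule x_cos_le_sin) (use assms in auto)
  moreover have "0 \<le> cos (t / 2)" using assms by (intro cos_ge_zero) auto
  ultimately have "2 * (t / 2 * cos (t / 2)) * cos (t / 2) \<le> 2 * sin (t / 2) * cos (t / 2)"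
    by (intro mult_right_mono) auto
  also have "\<dots> = sin t" using sin_double[of "t / 2"] by simp
  finally have 1: "t * (cos (t / 2))\<^sup>2 \<le> sin t" by (simp add: power2_eq_square mult.assoc)
  have "cos t = 2 * (cos (t / 2))\<^sup>2 - 1" using cos_double_cos[of "t / 2"] by simp
  hence "1 / 2 \<le> (cos (t / 2))\<^sup>2" using c by simp
  from mult_left_mono[OF this assms(1)] 1 show ?thesis by simp
qed

text \<open>
  For \<open>x = kappa_bar \<alpha> \<theta> * n powr \<alpha>\<close> the saddle points of the integrand have arguments \<open>\<plusminus>\<theta>\<close>. The line
  through them is \<open>\<sigma> = cos \<theta> * (sin \<theta> / sin ((1 + \<alpha>) * \<theta>)) powr (1 / \<alpha>)\<close>, and \<open>\<sigma> * X\<close> and the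
  maximal kernel \<open>m\<close> on it are the two parts of the exponent. What remains is uniformity: for
  \<open>\<alpha> > \<alpha>0\<close> and \<open>\<theta> < \<theta>0\<close> the quantities \<open>X / n\<close> and \<open>\<sigma>\<close> are bounded away from \<open>0\<close>, and \<open>m\<close> is bounded.
\<close>

lemma abs_W_le_saddle:
  fixes \<alpha>0 \<theta>0 \<beta> :: real
  assumes "0 < \<alpha>0" "0 < \<theta>0" "\<theta>0 < pi / 2"
  shows "\<exists>C0>0. \<forall>(\<alpha>::real) (\<theta>::real) (n::nat) (x::real).
           \<alpha>0 < \<alpha> \<and> \<alpha> < 1 \<and> 1 - 1 / \<alpha> \<le> \<beta> \<and> 0 < \<theta> \<and> \<theta> < \<theta>0 \<and> 1 \<le> n \<and>
           x = kappa_bar \<alpha> \<theta> * real n powr \<alpha> \<longrightarrow>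
           \<bar>W \<alpha> \<beta> n x\<bar> \<le>
             C0 * (cos \<theta> * (sin \<theta> / sin ((1 + \<alpha>) * \<theta>)) powr (1 / \<alpha>))
                    powr (beta_bar \<alpha> \<beta> + 1 / 2)
             * x powr beta_sub \<alpha> \<beta>
             * exp (real n * (- \<alpha> * (sin ((1 + \<alpha>) * \<theta>) * cos \<theta> / sin (\<alpha> * \<theta>))
                              + ln (sin \<theta> / sin (\<alpha> * \<theta>))))"
proof -
  define k where "k = cos \<theta>0"
  have k: "0 < k" "k \<le> 1" using assms by (auto simp: k_def intro!: cos_gt_zero)
  define c where "c = \<alpha>0 * (k powr (1 / \<alpha>0) * k)"
  have c: "c > 0" using assms k by (simp add: c_def)
  define s where "s = k * (1 / 2) powr (1 / \<alpha>0)"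
  have s: "0 < s" using k by (simp add: s_def)
  have "(1 / 2) powr (1 / \<alpha>0) \<le> (1::real)" using assms by (intro powr_le1) auto
  hence s1: "s \<le> 1" unfolding s_def using k mult_mono[of k 1 "(1 / 2) powr (1 / \<alpha>0)" 1] by simp
  obtain K where K: "K > 0" and bound:
    "\<And>\<alpha> \<sigma> m x n. \<lbrakk>0 < \<alpha>; \<alpha> \<le> 1; 1 - 1 / \<alpha> \<le> \<beta>; 0 < \<sigma>; \<sigma> < 1; 1 / 2 \<le> \<alpha> * m; 0 < x;
        c * real n \<le> x powr (1 / \<alpha>);
        \<And>v. Re v = \<sigma> \<Longrightarrow> norm (v powr complex_of_real \<alpha>) \<le> m * norm (v powr complex_of_real \<alpha> - 1)\<rbrakk>
      \<Longrightarrow> \<bar>W \<alpha> \<beta> n x\<bar> \<le> K * (m / \<sigma>) * (x powr beta_sub \<alpha> \<beta> * (m ^ n * exp (- \<sigma> * x powr (1 / \<alpha>))))"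
    using abs_W_le_line[OF c, of \<beta>] by metis
  define D where "D = 2 / \<alpha>0 / s"
  define C0 where "C0 = K * D / s powr (1 + \<bar>\<beta>\<bar> + 1 / 2)"
  have D: "D > 0" using assms s by (simp add: D_def)
  show ?thesis
  proof (intro exI[of _ C0] conjI allI impI, goal_cases)
    case 1
    show ?case using K D s by (simp add: C0_def)
  next
    case (2 \<alpha> \<theta> n x)
    hence a: "\<alpha>0 < \<alpha>" "0 < \<alpha>" "\<alpha> \<le> 1" "\<alpha> < 1" "1 - 1 / \<alpha> \<le> \<beta>" and \<theta>: "0 < \<theta>" "\<theta> < \<theta>0" "\<theta> < pi / 2"
      and n: "1 \<le> n" and x: "x = kappa_bar \<alpha> \<theta> * real n powr \<alpha>"
      using assms by auto
    define S where "S = sin ((1 + \<alpha>) * \<theta>)"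
    define A where "A = sin (\<alpha> * \<theta>)"
    define \<sigma> where "\<sigma> = cos \<theta> * (sin \<theta> / S) powr (1 / \<alpha>)"
    define m where "m = sin \<theta> / A"
    note a\<theta> = scaled_angle[OF a(2,3) \<theta>(1,3)]
    have pos: "S > 0" "sin \<theta> > 0" "cos \<theta> > 0" "A > 0" "cos (\<alpha> * \<theta>) > 0"
      using a a\<theta> \<theta> sin_add_one_pos[of \<alpha> \<theta>] unfolding S_def A_def
      by (auto intro!: sin_gt_zero cos_gt_zero)
    have k\<theta>: "k \<le> cos \<theta>" "k \<le> cos (\<alpha> * \<theta>)"
      unfolding k_def using \<theta> a\<theta> assms by (auto intro!: cos_monotone_0_pi_le)
    have S: "S = sin \<theta> * cos (\<alpha> * \<theta>) + cos \<theta> * A"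
      by (simp add: S_def A_def distrib_right sin_add)
    have "sin \<theta> * k \<le> sin \<theta> * cos (\<alpha> * \<theta>)" using k\<theta>(2) pos by (intro mult_left_mono) auto
    moreover have "0 < cos \<theta> * A" using pos by simp
    ultimately have Ssin: "k * sin \<theta> \<le> S" unfolding S mult.commute[of k] by linarith
    have "k * A \<le> cos \<theta> * A" using k\<theta>(1) pos by (intro mult_right_mono) auto
    moreover have "0 < sin \<theta> * cos (\<alpha> * \<theta>)" using pos by simp
    ultimately have SA: "k * A \<le> S" unfolding S by linarith
    have "A \<le> sin \<theta>" unfolding A_def using a\<theta> \<theta> by (intro sin_monotone_2pi_le) auto
    hence "cos \<theta> * A \<le> 1 * sin \<theta>" using pos by (intro mult_mono) auto
    moreover have "sin \<theta> * cos (\<alpha> * \<theta>) \<le> sin \<theta> * 1" using pos by (intro mult_left_mono) auto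
    ultimately have S2: "S \<le> 2 * sin \<theta>" unfolding S by simp
    \<comment> \<open>The line stays within \<open>[s, 1)\<close>, so that the power of \<open>\<sigma>\<close> in the claim only costs a constant.\<close>
    have \<sigma>0: "0 < \<sigma>" using pos by (simp add: \<sigma>_def)
    have "\<sigma> powr \<alpha> = cos \<theta> powr \<alpha> * (sin \<theta> / S)"
      using pos a by (simp add: \<sigma>_def powr_mult powr_powr)
    hence "\<sigma> powr \<alpha> = saddle_locus \<alpha> \<theta>" by (simp add: saddle_locus_def S_def)
    also have "\<dots> \<le> 1 / (1 + \<alpha>)" using saddle_locus_le a \<theta> by auto
    also have "\<dots> < 1" using a by simp
    finally have "\<sigma> powr \<alpha> < 1" .
    hence \<sigma>1: "\<sigma> < 1" using a \<sigma>0 ge_one_powr_ge_zero[of \<sigma> \<alpha>] by (cases "\<sigma> < 1") auto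
    have s\<sigma>: "s \<le> \<sigma>"
    proof -
      have "(1 / 2) powr (1 / \<alpha>0) \<le> (1 / 2 :: real) powr (1 / \<alpha>)"
        using a assms by (intro powr_mono') (auto simp: frac_le)
      also have "\<dots> \<le> (sin \<theta> / S) powr (1 / \<alpha>)"
        using a pos S2 by (intro powr_mono2) (auto simp: field_simps)
      finally show ?thesis unfolding s_def \<sigma>_def using k\<theta> k pos by (intro mult_mono) auto
    qed
    \<comment> \<open>The maximum \<open>m\<close> of the kernel is of order \<open>1 / \<alpha>\<close>: the line bound needs this
      from below, the uniform constant from above.\<close>
    have "\<theta> / 2 \<le> sin \<theta>" using half_le_sin \<theta> by auto
    moreover have "A \<le> \<alpha> * \<theta>" unfolding A_def using a\<theta> by (intro sin_x_le_x) auto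
    moreover have "\<alpha> * (\<theta> / 2) \<le> \<alpha> * sin \<theta>" using \<open>\<theta> / 2 \<le> sin \<theta>\<close> a by (intro mult_left_mono) auto
    ultimately have "A / 2 \<le> \<alpha> * sin \<theta>" by simp
    hence m2: "1 / 2 \<le> \<alpha> * m" using pos by (simp add: m_def field_simps)
    have mD: "m \<le> 2 / \<alpha>0"
    proof -
      have "\<alpha> * \<theta> / 2 \<le> A" unfolding A_def using half_le_sin[of "\<alpha> * \<theta>"] a\<theta> \<theta> by auto
      moreover have "sin \<theta> \<le> \<theta>" using \<theta> by (intro sin_x_le_x) auto
      ultimately have "m \<le> \<theta> / (\<alpha> * \<theta> / 2)" unfolding m_def using a\<theta> \<theta> by (intro frac_le) auto
      also have "\<dots> = 2 / \<alpha>" using \<theta> by simp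
      also have "\<dots> \<le> 2 / \<alpha>0" using a assms by (intro divide_left_mono) auto
      finally show ?thesis .
    qed
    have m0: "m > 0" using pos by (simp add: m_def)
    \<comment> \<open>In \<open>\<sigma> * X\<close> the \<open>1 / \<alpha>\<close>-th powers in \<open>\<sigma>\<close> and in \<open>kappa_bar \<alpha> \<theta> powr (1 / \<alpha>)\<close> cancel.\<close>
    define X where "X = x powr (1 / \<alpha>)"
    have kap: "kappa_bar \<alpha> \<theta> = \<alpha> powr \<alpha> * (S / sin \<theta>) * (S / A) powr \<alpha>"
      by (simp add: kappa_bar_def S_def A_def)
    have kap0: "kappa_bar \<alpha> \<theta> > 0" unfolding kap using a pos by simp
    have x0: "x > 0" using kap0 n by (simp add: x)
    have X: "X = \<alpha> * ((S / sin \<theta>) powr (1 / \<alpha>) * (S / A)) * real n"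
      unfolding X_def x using kap0 a n pos
      by (simp add: powr_root_scale kap powr_mult powr_powr powr_divide)
    have kS: "k powr (1 / \<alpha>0) * k \<le> (S / sin \<theta>) powr (1 / \<alpha>) * (S / A)"
    proof (intro mult_mono)
      have "k powr (1 / \<alpha>0) \<le> k powr (1 / \<alpha>)" using a assms k by (intro powr_mono') (auto simp: frac_le)
      also have "\<dots> \<le> (S / sin \<theta>) powr (1 / \<alpha>)"
        using a pos k Ssin by (intro powr_mono2) (auto simp: field_simps)
      finally show "k powr (1 / \<alpha>0) \<le> (S / sin \<theta>) powr (1 / \<alpha>)" .
      show "k \<le> S / A" using SA pos by (simp add: field_simps)
    qed (use k in auto)
    have "c \<le> \<alpha> * ((S / sin \<theta>) powr (1 / \<alpha>) * (S / A))"
      unfolding c_def by (rule mult_mono[OF _ kS]) (use a assms k in auto)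
    hence cX: "c * real n \<le> x powr (1 / \<alpha>)"
      unfolding X_def[symmetric] X by (intro mult_right_mono) auto
    have "(sin \<theta> / S) powr (1 / \<alpha>) * (S / sin \<theta>) powr (1 / \<alpha>) = 1"
      using pos by (simp add: powr_mult[symmetric])
    moreover have "\<sigma> * X = real n * (\<alpha> * (S * cos \<theta> / A)) *
        ((sin \<theta> / S) powr (1 / \<alpha>) * (S / sin \<theta>) powr (1 / \<alpha>))"
      by (simp add: \<sigma>_def X)
    ultimately have \<sigma>X: "- \<sigma> * X = real n * (- \<alpha> * (S * cos \<theta> / A))" by simp
    have line: "norm (v powr \<alpha>) \<le> m * norm (v powr \<alpha> - 1)" if "Re v = \<sigma>" for v
      unfolding m_def A_def
      by (rule kernel_on_line_saddle[OF a(2,3) \<theta>(1,3) _ that]) (simp add: \<sigma>_def S_def)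
    have "\<bar>W \<alpha> \<beta> n x\<bar> \<le> K * (m / \<sigma>) * (x powr beta_sub \<alpha> \<beta> * (m ^ n * exp (- \<sigma> * X)))"
      unfolding X_def by (rule bound) (use a \<sigma>0 \<sigma>1 m2 x0 cX line in auto)
    also have "m ^ n * exp (- \<sigma> * X) = exp (real n * (- \<alpha> * (S * cos \<theta> / A) + ln m))"
      unfolding \<sigma>X power_eq_exp_ln[OF m0] distrib_left exp_add by (rule mult.commute)
    also have "K * (m / \<sigma>) * (x powr beta_sub \<alpha> \<beta> * exp (real n * (- \<alpha> * (S * cos \<theta> / A) + ln m)))
      \<le> C0 * \<sigma> powr (beta_bar \<alpha> \<beta> + 1 / 2) *
        (x powr beta_sub \<alpha> \<beta> * exp (real n * (- \<alpha> * (S * cos \<theta> / A) + ln m)))"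
    proof (rule mult_right_mono)
      have "m / \<sigma> \<le> D" unfolding D_def using mD m0 s s\<sigma> assms by (intro frac_le) auto
      hence "K * (m / \<sigma>) \<le> K * D" by (rule mult_left_mono) (use K in simp)
      also have "\<dots> = C0 * s powr (1 + \<bar>\<beta>\<bar> + 1 / 2)" using s by (simp add: C0_def)
      also have "\<dots> \<le> C0 * \<sigma> powr (beta_bar \<alpha> \<beta> + 1 / 2)"
      proof (rule mult_left_mono)
        note p = parameter_bounds[OF a(2,3,5)]
        have "s powr (1 + \<bar>\<beta>\<bar> + 1 / 2) \<le> s powr (beta_bar \<alpha> \<beta> + 1 / 2)"
          using s s1 p by (intro powr_mono') auto
        also have "\<dots> \<le> \<sigma> powr (beta_bar \<alpha> \<beta> + 1 / 2)"
          using s s\<sigma> p by (intro powr_mono2) auto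
        finally show "s powr (1 + \<bar>\<beta>\<bar> + 1 / 2) \<le> \<sigma> powr (beta_bar \<alpha> \<beta> + 1 / 2)" .
        show "0 \<le> C0" using K D s by (simp add: C0_def)
      qed
      finally show "K * (m / \<sigma>) \<le> C0 * \<sigma> powr (beta_bar \<alpha> \<beta> + 1 / 2)" .
    qed simp
    finally show ?case
      by (simp only: \<sigma>_def S_def A_def m_def mult.assoc)
  qed
qed

text \<open>
  Off the sector \<open>\<bar>Arg v\<bar> < \<psi>\<close> the distance of \<open>v powr (- \<alpha>)\<close> from \<open>1\<close> is at least \<open>sin (\<alpha> * \<psi>)\<close>. The
  points of the line \<open>Re v = \<sigma>\<close> inside the sector are so close to \<open>0\<close> that \<open>\<bar>v powr (- \<alpha>)\<bar> \<ge> 2\<close>, and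
  for large \<open>\<bar>v\<bar>\<close> the power \<open>v powr (- \<alpha>)\<close> is close to \<open>0\<close>.
\<close>

lemma kernel_ge_sin:
  fixes \<alpha> \<psi> \<sigma> R :: real and v :: complex
  assumes "0 < \<alpha>" "\<alpha> \<le> 1" "0 < \<psi>" "\<psi> < pi / 2" "0 < \<sigma>" "0 < R"
    and \<sigma>: "2 \<le> (cos \<psi> / \<sigma>) powr \<alpha>" and R: "1 - sin (\<alpha> * \<psi>) \<ge> R powr (- \<alpha>)"
    and v: "0 < Re v" "Re v = \<sigma> \<or> R \<le> norm v"
  shows "norm (v powr \<alpha>) * sin (\<alpha> * \<psi>) \<le> norm (v powr \<alpha> - 1)"
proof -
  note a\<psi> = scaled_angle[OF assms(1-4)]
  hence sp: "0 \<le> sin (\<alpha> * \<psi>)" by (intro sin_ge_zero) auto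
  show ?thesis
  proof (cases "R \<le> norm v")
    case True
    have "R powr \<alpha> \<le> norm v powr \<alpha>" using True assms by (intro powr_mono2) auto
    hence "1 * R powr \<alpha> \<le> norm v powr \<alpha>" by simp
    hence "1 * R powr \<alpha> * R powr (- \<alpha>) \<le> norm v powr \<alpha> * R powr (- \<alpha>)" by (intro mult_right_mono) auto
    hence "1 \<le> norm v powr \<alpha> * R powr (- \<alpha>)" using assms by (simp add: powr_minus)
    also have "\<dots> \<le> norm v powr \<alpha> * (1 - sin (\<alpha> * \<psi>))" using R by (intro mult_left_mono) auto
    finally have "norm (v powr \<alpha>) * sin (\<alpha> * \<psi>) \<le> norm (v powr \<alpha>) - 1"
      by (simp add: norm_powr_real_powr' algebra_simps)
    also have "\<dots> \<le> norm (v powr \<alpha> - 1)" using norm_triangle_ineq2[of "v powr \<alpha>" 1] by simp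
    finally show ?thesis .
  next
    case False
    hence rv: "Re v = \<sigma>" using v by blast
    define t where "t = \<bar>Im (Ln v)\<bar>"
    define s where "s = (cos t / \<sigma>) powr \<alpha>"
    have polar: "(norm (v powr \<alpha> - 1))\<^sup>2 = (norm (v powr \<alpha>))\<^sup>2 * (1 - 2 * s * cos (\<alpha> * t) + s\<^sup>2)"
      and t: "0 \<le> t" "t < pi / 2"
      using norm_powr_minus_one_polar(1)[of v \<alpha>] norm_powr_minus_one_polar(2,3)[of v] v(1) rv
      by (simp_all add: t_def s_def)
    have at: "0 \<le> \<alpha> * t" "\<alpha> * t \<le> t" using assms t by (auto simp: mult_left_le_one_le)
    have "(sin (\<alpha> * \<psi>))\<^sup>2 \<le> 1 - 2 * s * cos (\<alpha> * t) + s\<^sup>2"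
    proof (cases "\<psi> \<le> t")
      case True
      hence "\<alpha> * \<psi> \<le> \<alpha> * t" using assms by (intro mult_left_mono) auto
      hence "sin (\<alpha> * \<psi>) \<le> sin (\<alpha> * t)"
        using a\<psi> at t by (intro sin_monotone_2pi_le; linarith)
      hence "(sin (\<alpha> * \<psi>))\<^sup>2 \<le> (sin (\<alpha> * t))\<^sup>2" using sp by (intro power_mono) auto
      also have "\<dots> \<le> (s - cos (\<alpha> * t))\<^sup>2 + (sin (\<alpha> * t))\<^sup>2" by simp
      also have "\<dots> = 1 - 2 * s * cos (\<alpha> * t) + s\<^sup>2"
        by (simp add: sin_squared_eq power2_eq_square algebra_simps)
      finally show ?thesis .
    next
      case False
      hence "cos \<psi> \<le> cos t" using t assms by (intro cos_monotone_0_pi_le) auto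
      moreover have "0 < cos \<psi>" using assms by (intro cos_gt_zero) auto
      ultimately have "(cos \<psi> / \<sigma>) powr \<alpha> \<le> s"
        unfolding s_def using assms by (intro powr_mono2 divide_right_mono) auto
      hence s2: "2 \<le> s" using \<sigma> by linarith
      have "(sin (\<alpha> * \<psi>))\<^sup>2 \<le> 1" by (simp add: abs_square_le_1)
      also have "1 \<le> (s - 1)\<^sup>2" using s2 by (simp add: one_le_power)
      also have "\<dots> = 1 - 2 * s * 1 + s\<^sup>2" by (simp add: power2_eq_square algebra_simps)
      also have "\<dots> \<le> 1 - 2 * s * cos (\<alpha> * t) + s\<^sup>2"
        using s2 mult_left_mono[of "cos (\<alpha> * t)" 1 "2 * s"] by simp
      finally show ?thesis .
    qed
    hence "(norm (v powr \<alpha>) * sin (\<alpha> * \<psi>))\<^sup>2 \<le> (norm (v powr \<alpha> - 1))\<^sup>2"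
      unfolding polar power_mult_distrib by (intro mult_left_mono) auto
    thus ?thesis by (rule power2_le_imp_le) simp
  qed
qed

text \<open>
  Here the rectangle depends on \<open>\<alpha>\<close> and \<open>\<psi>\<close> but not on \<open>n\<close>, and \<open>exp (- X * Re v) \<le> 1\<close> is all that is
  used of the exponential.
\<close>

lemma abs_W_le_csc_power:
  fixes \<alpha> \<beta> \<psi> x :: real
  assumes "0 < \<alpha>" "\<alpha> < 1" "1 - 1 / \<alpha> \<le> \<beta>" "0 < x" "0 < \<psi>" "\<psi> < pi / 2"
  obtains K where "\<And>n. \<bar>W \<alpha> \<beta> n x\<bar> \<le> K * (1 / sin (\<alpha> * \<psi>)) ^ n"
proof -
  have a1: "\<alpha> \<le> 1" using assms by simp
  note p = parameter_bounds[OF assms(1) a1 assms(3)]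
  note a\<psi> = scaled_angle[OF assms(1) a1 assms(5,6)]
  define S where "S = sin (\<alpha> * \<psi>)"
  have S0: "0 < S" unfolding S_def using a\<psi> by (intro sin_gt_zero) auto
  have S1: "S < 1" unfolding S_def using a\<psi> sin_monotone_2pi[of "\<alpha> * \<psi>" "pi / 2"] by simp
  define \<sigma> where "\<sigma> = min (1 / 2) (cos \<psi> * (1 / 2) powr (1 / \<alpha>))"
  have cp: "0 < cos \<psi>" using assms by (intro cos_gt_zero) auto
  have \<sigma>: "0 < \<sigma>" "\<sigma> < 1" using cp by (auto simp: \<sigma>_def)
  define R where "R = max 2 ((1 - S) powr (- 1 / \<alpha>))"
  have R: "2 \<le> R" by (simp add: R_def)
  have "\<sigma> \<le> cos \<psi> * (1 / 2) powr (1 / \<alpha>)" by (simp add: \<sigma>_def)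
  hence "1 / (1 / 2) powr (1 / \<alpha>) \<le> cos \<psi> / \<sigma>" using \<sigma> by (simp add: field_simps)
  hence "(1 / (1 / 2) powr (1 / \<alpha>)) powr \<alpha> \<le> (cos \<psi> / \<sigma>) powr \<alpha>" using assms by (intro powr_mono2) auto
  hence c\<sigma>: "2 \<le> (cos \<psi> / \<sigma>) powr \<alpha>" using assms by (simp add: powr_divide powr_powr)
  have "R powr (- \<alpha>) \<le> ((1 - S) powr (- 1 / \<alpha>)) powr (- \<alpha>)"
    using S1 assms by (intro powr_mono2') (auto simp: R_def)
  also have "\<dots> = 1 - S" unfolding powr_powr using S1 assms by simp
  finally have cR: "1 - sin (\<alpha> * \<psi>) \<ge> R powr (- \<alpha>)" by (simp add: S_def)
  define B where "B = (2 * R) powr (1 + \<bar>\<beta>\<bar>) / \<sigma>"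
  have B: "B \<ge> 0" using \<sigma> by (simp add: B_def)
  show thesis
  proof (rule that)
    fix n :: nat
    have M0: "0 \<le> B * (1 / S) ^ Suc n" using B S0 by simp
    have "\<bar>W \<alpha> \<beta> n x\<bar> \<le> x powr beta_sub \<alpha> \<beta> * (B * (1 / S) ^ Suc n) * (R + 2 * R) / Gamma (\<alpha> * \<beta> + 1)"
    proof (rule abs_W_le_rectangle[OF assms(1) a1 assms(3,4) \<sigma> _ _ M0])
      fix v assume v: "\<sigma> \<le> Re v" "Re v \<le> R" "\<bar>Im v\<bar> \<le> R" "Re v = \<sigma> \<or> Re v = R \<or> \<bar>Im v\<bar> = R"
      have "Re v = \<sigma> \<or> R \<le> norm v"
        using v(4) abs_Re_le_cmod[of v] abs_Im_le_cmod[of v] by auto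
      moreover have "0 < Re v" using v \<sigma> by simp
      ultimately have "norm (v powr \<alpha>) * S \<le> norm (v powr \<alpha> - 1)"
        unfolding S_def using R \<sigma>(1) assms a1 c\<sigma> cR by (intro kernel_ge_sin[where \<sigma> = \<sigma> and R = R]) auto
      hence "norm (v powr \<alpha>) \<le> 1 / S * norm (v powr \<alpha> - 1)" using S0 by (simp add: field_simps)
      hence "norm (v powr \<alpha>) / norm (v powr \<alpha> - 1) \<le> 1 / S"
        using S0 by (intro divide_le_of_le_mult) auto
      hence 1: "(norm (v powr \<alpha>) / norm (v powr \<alpha> - 1)) ^ Suc n \<le> (1 / S) ^ Suc n"
        by (intro power_mono) auto
      have 2: "norm v powr (beta_bar \<alpha> \<beta> - 1) \<le> B" unfolding B_def
        using rectangle_norm_bounds[OF \<sigma>(1) v(1-3)] p \<sigma> R by (intro norm_powr_diff_one_le) auto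
      have "0 \<le> x powr (1 / \<alpha>) * Re v" using \<open>0 < Re v\<close> by simp
      hence 3: "exp (- (x powr (1 / \<alpha>)) * Re v) \<le> 1" by simp
      have "norm v powr (beta_bar \<alpha> \<beta> - 1) * (norm (v powr \<alpha>) / norm (v powr \<alpha> - 1)) ^ Suc n
          * exp (- (x powr (1 / \<alpha>)) * Re v) \<le> B * (1 / S) ^ Suc n * 1"
        by (rule mult_mono[OF mult_mono[OF 2 1] 3]) (use B M0 in auto)
      thus "norm v powr (beta_bar \<alpha> \<beta> - 1) * (norm (v powr \<alpha>) / norm (v powr \<alpha> - 1)) ^ Suc n
          * exp (- (x powr (1 / \<alpha>)) * Re v) \<le> B * (1 / S) ^ Suc n" by simp
    qed (use R in auto)
    also have "\<dots> = x powr beta_sub \<alpha> \<beta> * (B / S) * (R + 2 * R) / Gamma (\<alpha> * \<beta> + 1) * (1 / S) ^ n" by simp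
    finally show "\<bar>W \<alpha> \<beta> n x\<bar> \<le> x powr beta_sub \<alpha> \<beta> * (B / S) * (R + 2 * R) / Gamma (\<alpha> * \<beta> + 1)
        * (1 / sin (\<alpha> * \<psi>)) ^ n" by (simp only: S_def)
  qed
qed

text \<open>
  The angle \<open>\<alpha> * \<psi>\<close> is chosen half-way between \<open>(\<alpha> - \<epsilon>) * pi / 2\<close> and \<open>\<alpha> * pi / 2\<close>, which leaves an
  exponentially small factor to dominate \<open>n powr (3 / 2 - a)\<close> for every \<open>a\<close>.
\<close>

lemma W_bigo_fixed_point:
  fixes \<alpha> \<beta> a x \<epsilon> :: real
  assumes "0 < \<alpha>" "\<alpha> < 1" "1 - 1 / \<alpha> \<le> \<beta>" "0 < x" "0 < \<epsilon>" "\<epsilon> < \<alpha>"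
  shows "(\<lambda>n. \<bar>W \<alpha> \<beta> n x\<bar>) \<in>
          O(\<lambda>n. real n powr (3 / 2 - a) * csc ((\<alpha> - \<epsilon>) * (pi / 2)) ^ n * x powr (- a))"
proof -
  define \<phi> where "\<phi> = (\<alpha> - \<epsilon>) * (pi / 2)"
  define \<psi> where "\<psi> = (1 - \<epsilon> / (2 * \<alpha>)) * (pi / 2)"
  have r: "0 < \<epsilon> / (2 * \<alpha>)" "\<epsilon> / (2 * \<alpha>) < 1" using assms by (auto simp: field_simps)
  have "(1 - \<epsilon> / (2 * \<alpha>)) * (pi / 2) < 1 * (pi / 2)"
    using r by (intro mult_strict_right_mono) auto
  moreover have "0 < (1 - \<epsilon> / (2 * \<alpha>)) * (pi / 2)" using r by (intro mult_pos_pos) auto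
  ultimately have \<psi>: "0 < \<psi>" "\<psi> < pi / 2" unfolding \<psi>_def by auto
  have a\<psi>: "\<alpha> * \<psi> = (\<alpha> - \<epsilon> / 2) * (pi / 2)" unfolding \<psi>_def using assms by (simp add: field_simps)
  have \<phi>0: "0 < \<phi>" using assms by (simp add: \<phi>_def)
  have \<phi>\<psi>: "\<phi> < \<alpha> * \<psi>" unfolding a\<psi> \<phi>_def using assms by (intro mult_strict_right_mono) auto
  have "\<alpha> * \<psi> < 1 * (pi / 2)" unfolding a\<psi> using assms by (intro mult_strict_right_mono) auto
  hence s: "0 < sin \<phi>" "sin \<phi> < sin (\<alpha> * \<psi>)"
    using \<phi>0 \<phi>\<psi> by (auto intro!: sin_gt_zero sin_monotone_2pi)
  obtain K where K: "\<And>n. \<bar>W \<alpha> \<beta> n x\<bar> \<le> K * (1 / sin (\<alpha> * \<psi>)) ^ n"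
    using abs_W_le_csc_power[OF assms(1-4) \<psi>] by blast
  define d where "d = ln (sin (\<alpha> * \<psi>) / sin \<phi>)"
  have d: "d > 0" unfolding d_def using s by (subst ln_gt_zero_iff) auto
  have ratio: "(1 / sin (\<alpha> * \<psi>)) ^ n = exp (- d * real n) * (1 / sin \<phi>) ^ n" for n
  proof -
    have "exp (- d * real n) = (1 / exp d) ^ n"
      by (simp add: exp_minus exp_of_nat2_mult field_simps)
    also have "exp d = sin (\<alpha> * \<psi>) / sin \<phi>" using s by (simp add: d_def)
    finally show ?thesis using s by (simp add: power_mult_distrib[symmetric])
  qed
  have "(\<lambda>n. \<bar>W \<alpha> \<beta> n x\<bar>) \<in> O(\<lambda>n. (1 / sin (\<alpha> * \<psi>)) ^ n)"
    using K s by (intro bigoI[of _ K] always_eventually) auto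
  also have "(\<lambda>n. (1 / sin (\<alpha> * \<psi>)) ^ n) = (\<lambda>n. exp (- d * real n) * (1 / sin \<phi>) ^ n)"
    by (rule ext) (rule ratio)
  also have "\<dots> \<in> O(\<lambda>n. real n powr (3 / 2 - a) * (1 / sin \<phi>) ^ n)"
  proof (rule landau_o.big.mult_right)
    show "(\<lambda>n. exp (- d * real n)) \<in> O(\<lambda>n. real n powr (3 / 2 - a))"
      using d by real_asymp
  qed
  also have "\<dots> = O(\<lambda>n. real n powr (3 / 2 - a) * csc ((\<alpha> - \<epsilon>) * (pi / 2)) ^ n * x powr (- a))"
    using assms by (simp add: csc_def \<phi>_def)
  finally show ?thesis .
qed

section \<open>Bounds for \<open>W\<close> in all regimes of \<open>x\<close>\<close>

theorem proposition6p1: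
  fixes \<beta> :: real
  shows
    \<comment> \<open>preliminary claims\<close>
    "(\<forall>\<alpha>::real. 0 < \<alpha> \<and> \<alpha> < 1 \<and> 1 - 1 / \<alpha> \<le> \<beta> \<longrightarrow>
        beta_bar \<alpha> \<beta> = \<alpha> * \<beta> - \<alpha> + 1 \<and> 0 \<le> beta_bar \<alpha> \<beta>)
   \<and> (\<forall>\<alpha>::real. 0 < \<alpha> \<and> \<alpha> < 1 \<longrightarrow> C_bar \<alpha> \<le> B_bar \<alpha> \<and> B_bar \<alpha> \<le> A_bar \<alpha>)
   \<and> \<comment> \<open>(1)\<close>
     (\<forall>(\<alpha>::real) (a::real) (x::real) (\<epsilon>::real).
        0 < \<alpha> \<and> \<alpha> < 1 \<and> 1 - 1 / \<alpha> \<le> \<beta> \<and> - beta_sub \<alpha> \<beta> < a \<and> 0 < x \<and> 0 < \<epsilon> \<and> \<epsilon> < \<alpha> \<longrightarrow>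
        (\<lambda>n. \<bar>W \<alpha> \<beta> n x\<bar>) \<in>
          O(\<lambda>n. real n powr (3 / 2 - a) * csc ((\<alpha> - \<epsilon>) * (pi / 2)) ^ n * x powr (- a)))
   \<and> \<comment> \<open>(2)\<close>
     (\<forall>\<alpha>::real. 0 < \<alpha> \<and> \<alpha> \<le> 1 \<longrightarrow>
        strict_antimono_on {0<..<pi / 2} (kappa_bar \<alpha>)
      \<and> (kappa_bar \<alpha> \<longlongrightarrow> A_bar \<alpha>) (at_right 0)
      \<and> kappa_bar \<alpha> (pi / (2 * (1 + \<alpha>))) = B_bar \<alpha>
      \<and> kappa_bar \<alpha> (pi / 2) = C_bar \<alpha>
      \<and> (kappa_bar \<alpha> \<longlongrightarrow> C_bar \<alpha>) (at_left (pi / 2)))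
   \<and> (\<forall>(\<alpha>0::real) (\<theta>0::real). 0 < \<alpha>0 \<and> \<alpha>0 < 1 \<and> 0 < \<theta>0 \<and> \<theta>0 < pi / 2 \<longrightarrow>
        (\<exists>C0>0. \<forall>(\<alpha>::real) (\<theta>::real) (n::nat) (x::real).
           \<alpha>0 < \<alpha> \<and> \<alpha> < 1 \<and> 1 - 1 / \<alpha> \<le> \<beta> \<and> 0 < \<theta> \<and> \<theta> < \<theta>0 \<and> 1 \<le> n \<and>
           x = kappa_bar \<alpha> \<theta> * real n powr \<alpha> \<longrightarrow>
           \<bar>W \<alpha> \<beta> n x\<bar> \<le>
             C0 * (cos \<theta> * (sin \<theta> / sin ((1 + \<alpha>) * \<theta>)) powr (1 / \<alpha>))
                    powr (beta_bar \<alpha> \<beta> + 1 / 2)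
             * x powr beta_sub \<alpha> \<beta>
             * exp (real n * (- \<alpha> * (sin ((1 + \<alpha>) * \<theta>) * cos \<theta> / sin (\<alpha> * \<theta>))
                              + ln (sin \<theta> / sin (\<alpha> * \<theta>))))))
   \<and> \<comment> \<open>(3), first range\<close>
     (\<forall>(\<alpha>0::real) (\<epsilon>::real). 0 < \<alpha>0 \<and> \<alpha>0 < 1 \<and> 0 < \<epsilon> \<longrightarrow>
        (\<exists>(n0::nat) (K::real). \<forall>n\<ge>n0. \<forall>(\<alpha>::real) (x::real).
           \<alpha>0 \<le> \<alpha> \<and> \<alpha> \<le> 1 \<and> 1 - 1 / \<alpha> \<le> \<beta> \<and> \<epsilon> < B_bar \<alpha> - C_bar \<alpha> \<and>
           (C_bar \<alpha> + \<epsilon>) * real n powr \<alpha> < x \<and> x < A_bar \<alpha> * real n powr \<alpha> \<longrightarrow>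
           \<bar>W \<alpha> \<beta> n x\<bar> \<le>
             K * (x powr beta_sub \<alpha> \<beta> * exp (- (1 / 2) * x powr (1 / \<alpha>))
                  * exp (real n * (- ln \<alpha> + 1 / 2 * (1 + \<alpha>) powr ((1 + \<alpha>) / \<alpha>) - 1 - \<alpha>)))))
   \<and> \<comment> \<open>(3), second range: no lower bound on \<open>\<alpha>\<close>; the implied constant is \<open>K / \<alpha>\<close>,
        since no constant independent of \<open>\<alpha>\<close> works as \<open>\<alpha>\<close> tends to \<open>0\<close>\<close>
     (\<exists>(n0::nat) (K::real). \<forall>n\<ge>n0. \<forall>(\<alpha>::real) (x::real).
        0 < \<alpha> \<and> \<alpha> \<le> 1 \<and> 1 - 1 / \<alpha> \<le> \<beta> \<and>
        B_bar \<alpha> * real n powr \<alpha> < x \<and> x < A_bar \<alpha> * real n powr \<alpha> \<longrightarrow>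
        \<bar>W \<alpha> \<beta> n x\<bar> \<le>
          K / \<alpha> * (x powr beta_sub \<alpha> \<beta> * exp (- (1 / 2) * x powr (1 / \<alpha>))
               * exp (real n * (- ln \<alpha> + 1 / 2 * (1 + \<alpha>) powr ((1 + \<alpha>) / \<alpha>) - 1 - \<alpha>))))
   \<and> \<comment> \<open>(4)\<close>
     (\<forall>\<eta><1. \<exists>(n0::nat) (K::real). \<forall>n\<ge>n0. \<forall>(\<alpha>::real) (x::real).
        0 < \<alpha> \<and> \<alpha> < 1 \<and> 1 - 1 / \<alpha> \<le> \<beta> \<and> 0 < x \<and> A_bar \<alpha> * real n powr \<alpha> \<le> x \<longrightarrow>
        \<bar>W \<alpha> \<beta> n x\<bar> \<le>
          K * (\<alpha> powr (- 5 / 2) * x powr beta_sub \<alpha> \<beta> * exp (- \<eta> * x powr (1 / \<alpha>))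
               * exp (real n * H \<alpha> \<eta>)))
   \<and> (\<forall>\<alpha>::real. 0 < \<alpha> \<and> \<alpha> < 1 \<longrightarrow> {1 / 2..<1} \<subseteq> E_int \<alpha>)
   \<and> (\<forall>(\<alpha>::real) (\<eta>::real). 0 < \<alpha> \<and> \<alpha> < 1 \<and> 0 < \<eta> \<and> \<eta> < 1 \<longrightarrow>
        H \<alpha> \<eta> = max (\<eta> * (1 + \<alpha>) powr ((\<alpha> + 1) / \<alpha>) - (\<alpha> + 1) - ln \<alpha>)
                    (- ln (\<eta> powr (- \<alpha>) - 1)))
   \<and> (\<exists>L::real \<Rightarrow> real.
        (\<forall>\<alpha>::real. 0 < \<alpha> \<and> \<alpha> < 1 \<longrightarrow> (H \<alpha> \<longlongrightarrow> L \<alpha>) (at (1 / 2)))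
      \<and> (L \<longlongrightarrow> 0) (at_left 1))"
proof (intro conjI, goal_cases)
  case 1
  show ?case using beta_bar_eq parameter_bounds(1) by simp
next
  case 2
  show ?case using C_bar_le_B_bar_le_A_bar by simp
next
  case 3
  show ?case by (intro allI impI, elim conjE, rule W_bigo_fixed_point)
next
  case 4
  show ?case
    using kappa_bar_strict_antimono kappa_bar_at_0 kappa_bar_at_B kappa_bar_at_half_pi kappa_bar_at_left
    by blast
next
  case 5
  show ?case by (intro allI impI, elim conjE, rule abs_W_le_saddle)
next
  case 6
  show ?case by (intro allI impI, elim conjE, rule abs_W_le_above_C_bar)
next
  case 7
  show ?case by (rule abs_W_le_above_B_bar)
next
  case 8
  show ?case by (intro allI impI, rule abs_W_le_above_A_bar)
next
  case 9
  show ?case using half_open_subset_E_int by simp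
next
  case 10
  show ?case using H_eq_max by simp
next
  case 11
  show ?case
    using tendsto_H_half tendsto_H_half_at_left by (intro exI[of _ "\<lambda>\<alpha>. H \<alpha> (1 / 2)"]) blast
qed

end
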